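(* Let $z\in\mathbb{C}$ with $\operatorname{Re} z>1$. The function $B_z:\mathbb{R}\to\mathbb{C}$ given by $$B_z(x)=\frac{1}{\Gamma(z)}\sum_{k=0}^{\infty}(-1)^k\binom{z}{k}(x-k)_+^{z-1}$$ is a polynomial spline of complex order $z$; that is, there exists a bounded sequence $(a_k)_{k\in\mathbb{N}_0}\in\ell^\infty(\mathbb{C})$ such that $f=B_z$ is a solution of the (distributional) fractional differential equation $$\mathcal{D}^z f=\sum_{k=0}^{\infty}a_k\,\delta(\bullet-k),$$ where equality is understood in $\Psi_+'$.
   Context: Notation. $\mathbb{N}_0=\{0,1,2,\dots\}$. For $t\in\mathbb{R}$ and $w\in\mathbb{C}$, the truncated power is $t_+^{w}:=t^{w}=e^{w\log t}$ for $t>0$ and $t_+^{w}:=0$ for $t<0$ (for $\operatorname{Re} w>0$, $t_+^w:=0$ at $t=0$). The binomial coefficient is $\binom{z}{k}=\frac{z(z-1)\cdots(z-k+1)}{k!}$. $\delta(\bullet-k)$ is the Dirac distribution at $k$. Test functions. $\Psi$ is the space of Schwartz functions $\psi:\mathbb{R}\to\mathbb{C}$ with $(D^m\psi)(0)=0$ for all $m\in\mathbb{N}_0$, with the topology of the Schwartz space; $\Psi_+:=\{\psi\in\Psi:\operatorname{supp}\psi\subseteq[0,\infty)\}$, and $\Psi_+'$ is its topological dual. Locally integrable functions $f$ of at most polynomial growth act by $\langle f,\varphi\rangle=\int_{\mathbb{R}}f(t)\varphi(t)\,dt$, and $\left\langle\sum_{k}a_k\delta(\bullet-k),\varphi\right\rangle=\sum_k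 a_k\varphi(k)$. Kernel. For $w\in\mathbb{C}$ with $\operatorname{Re}w>0$, $K_w(x):=\dfrac{x_+^{w-1}}{\Gamma(w)}$, regarded as a distribution supported in $[0,\infty)$; for other $w$, $K_w$ denotes the distribution obtained by analytic continuation in $w$ (so $K_0=\delta$). Convolution. For distributions $f,g$ supported in $[0,\infty)$, $\langle f*g,\varphi\rangle:=\langle f(x),\langle g(y),\varphi(x+y)\rangle\rangle$. Fractional derivative. For $\operatorname{Re}z>0$ and $m=\lceil\operatorname{Re}z\rceil$ (the smallest integer $\ge\operatorname{Re}z$), $\mathcal{D}^z f:=(D^m f)*K_{m-z}$, where $D^m$ is the $m$-th distributional derivative; i.e. $\langle\mathcal{D}^zf,\varphi\rangle=\langle(D^mf)*K_{m-z},\varphi\rangle$. Polynomial spline of complex order. For $\operatorname{Re}z>1$, a solution $f$ of $\mathcal{D}^zf=\sum_{k=0}^\infty a_k\,\delta(\bullet-k)$ for some bounded sequence $(a_k)_{k\in\mathbb{N}_0}$ is called a polynomial spline of complex order $z$. *)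

theory Defs
  imports "HOL-Analysis.Analysis"
begin

definition nderiv :: "nat \<Rightarrow> (real \<Rightarrow> complex) \<Rightarrow> real \<Rightarrow> complex" where
  "nderiv n = (\<lambda>f x. vector_derivative f (at x)) ^^ n"

definition smooth :: "(real \<Rightarrow> complex) \<Rightarrow> bool" where
  "smooth f \<longleftrightarrow> (\<forall>n x. nderiv n f differentiable (at x))"

text \<open>
  \<open>schwartz_space UNIV\<close> is the Schwartz space of the real line.  \<open>schwartz_space {0..}\<close> consists
  of the smooth functions on the line that are rapidly decreasing, with all their derivatives,
  towards plus infinity only.  The latter is the natural test space for distributions supported
  in \<open>{0..}\<close>: in \<open>\<langle>f(x), \<langle>g(y), \<phi>(x + y)\<rangle>\<rangle>\<close> neither \<open>y \<mapsto> \<phi>(x + y)\<close> nor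
  \<open>x \<mapsto> \<langle>g(y), \<phi>(x + y)\<rangle>\<close> need vanish on the negative half-line, and the second need not be
  rapidly decreasing towards minus infinity, even if \<open>\<phi>\<close> is a Schwartz function supported in
  \<open>{0..}\<close>.
\<close>

definition schwartz_seminorm :: "real set \<Rightarrow> nat \<Rightarrow> nat \<Rightarrow> (real \<Rightarrow> complex) \<Rightarrow> real" where
  "schwartz_seminorm X n m \<phi> = (SUP x\<in>X. \<bar>x\<bar> ^ n * cmod (nderiv m \<phi> x))"

definition schwartz_space :: "real set \<Rightarrow> (real \<Rightarrow> complex) set" where
  "schwartz_space X =
     {\<phi>. smooth \<phi> \<and> (\<forall>n m. bdd_above ((\<lambda>x. \<bar>x\<bar> ^ n * cmod (nderiv m \<phi> x)) ` X))}"

definition schwartz_topology :: "real set \<Rightarrow> (real \<Rightarrow> complex) topology" where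
  "schwartz_topology X = topology_generated_by
     {{\<psi> \<in> schwartz_space X. schwartz_seminorm X n m (\<lambda>x. \<psi> x - \<phi> x) < \<epsilon>} | n m \<phi> \<epsilon>.
        \<phi> \<in> schwartz_space X \<and> \<epsilon> > 0}"

type_synonym functional = "(real \<Rightarrow> complex) \<Rightarrow> complex"

text \<open>Functionals are total functions; only their values on the test space \<open>V\<close> matter.\<close>

definition linear_functional_on :: "(real \<Rightarrow> complex) set \<Rightarrow> functional \<Rightarrow> bool" where
  "linear_functional_on V T \<longleftrightarrow>
     (\<forall>\<phi>\<in>V. \<forall>\<psi>\<in>V. \<forall>c d. T (\<lambda>x. c * \<phi> x + d * \<psi> x) = c * T \<phi> + d * T \<psi>)"

definition topological_dual ::
    "(real \<Rightarrow> complex) topology \<Rightarrow> (real \<Rightarrow> complex) set \<Rightarrow> functional set" where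
  "topological_dual \<tau> V =
     {T. linear_functional_on V T \<and> continuous_map (subtopology \<tau> V) euclidean T}"

definition Psi :: "(real \<Rightarrow> complex) set" where
  "Psi = {\<psi> \<in> schwartz_space UNIV. \<forall>m. nderiv m \<psi> 0 = 0}"

definition Psi_plus :: "(real \<Rightarrow> complex) set" where
  "Psi_plus = {\<psi> \<in> Psi. closure {x. \<psi> x \<noteq> 0} \<subseteq> {0..}}"

definition Psi_plus_dual :: "functional set" where
  "Psi_plus_dual = topological_dual (schwartz_topology UNIV) Psi_plus"

definition eq_in_Psi_plus_dual :: "functional \<Rightarrow> functional \<Rightarrow> bool" where
  "eq_in_Psi_plus_dual S T \<longleftrightarrow>
     S \<in> Psi_plus_dual \<and> T \<in> Psi_plus_dual \<and> (\<forall>\<phi>\<in>Psi_plus. S \<phi> = T \<phi>)"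

text \<open>
  The tempered distributions supported in \<open>{0..}\<close>: continuity with respect to the seminorms
  over \<open>{0..}\<close> forces \<open>T \<phi>\<close> to depend only on the restriction of \<open>\<phi>\<close> to \<open>{0..}\<close>.
\<close>

definition half_line_distributions :: "functional set" where
  "half_line_distributions =
     topological_dual (schwartz_topology {0..}) (schwartz_space {0..})"

definition slowly_growing :: "(real \<Rightarrow> complex) \<Rightarrow> bool" where
  "slowly_growing f \<longleftrightarrow>
     (\<forall>a b. f absolutely_integrable_on {a..b}) \<and>
     (\<exists>C N. \<forall>t. cmod (f t) \<le> C * (1 + \<bar>t\<bar>) ^ N)"

definition regular_dist :: "(real \<Rightarrow> complex) \<Rightarrow> functional" where
  "regular_dist f \<phi> = (LINT t|lebesgue. f t * \<phi> t)"

definition dirac_series :: "(nat \<Rightarrow> complex) \<Rightarrow> functional" where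
  "dirac_series a \<phi> = (\<Sum>k. a k * \<phi> (real k))"

definition dist_deriv :: "nat \<Rightarrow> functional \<Rightarrow> functional" where
  "dist_deriv m T \<phi> = (- 1) ^ m * T (nderiv m \<phi>)"

definition convolution :: "functional \<Rightarrow> functional \<Rightarrow> functional" where
  "convolution S T \<phi> = S (\<lambda>x. T (\<lambda>y. \<phi> (x + y)))"

definition truncated_power :: "real \<Rightarrow> complex \<Rightarrow> complex" where
  "truncated_power t w = (if t > 0 then of_real t powr w else 0)"

text \<open>
  For a test function \<open>\<phi>\<close> in \<open>schwartz_space {0..}\<close>, the number \<open>\<langle>K\<^sub>w, \<phi>\<rangle>\<close> is the value at \<open>w\<close> of
  the entire function that continues \<open>v \<mapsto> \<integral> t\<^sub>+\<^sup>v\<^sup>-\<^sup>1 / \<Gamma>(v) \<phi>(t) dt\<close> from the half-plane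
  \<open>Re v > 0\<close>; it is unique by the identity theorem.
\<close>

definition K :: "complex \<Rightarrow> functional" where
  "K w \<phi> = (THE F. F holomorphic_on UNIV \<and>
      (\<forall>v. Re v > 0 \<longrightarrow> F v = regular_dist (\<lambda>t. truncated_power t (v - 1) / Gamma v) \<phi>)) w"

definition frac_deriv :: "complex \<Rightarrow> functional \<Rightarrow> functional" where
  "frac_deriv z T =
     (let m = nat \<lceil>Re z\<rceil> in convolution (dist_deriv m T) (K (of_nat m - z)))"

definition polynomial_spline :: "complex \<Rightarrow> functional \<Rightarrow> bool" where
  "polynomial_spline z T \<longleftrightarrow> Re z > 1 \<and> T \<in> half_line_distributions \<and>
     (\<exists>a. bounded (range a) \<and> eq_in_Psi_plus_dual (frac_deriv z T) (dirac_series a))"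

definition B_spline :: "complex \<Rightarrow> real \<Rightarrow> complex" where
  "B_spline z x =
     1 / Gamma z * (\<Sum>k. (- 1) ^ k * (z gchoose k) * truncated_power (x - real k) (z - 1))"

end

(*
With a_k = (-1)^k binom(z,k), the spline is B_z = sum_k a_k K_z(. - k), and sum_k |a_k| < oo
because |a_k| = O(k^(-Re z - 1)).  For Re w > 0 the pairing riesz w phi = <K_w, phi> is an
absolutely convergent integral, integration by parts gives <K_(w+1), phi'> = -<K_w, phi>, and the
latter relation continues the pairing to all w; in particular K_w for Re w >= 0 is represented by
the function K_(w+1) acting on -phi'.  Fubini's theorem and the Beta integral give the
semigroup law K_a * K_b = K_(a+b).  With m = ceiling (Re z) and w = m - z this turns D^z B_z into
sum_k a_k <K_z * K_(m-z+1), phi^(m+1)(k + .)> up to the sign (-1)^(m+1), and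
<K_(m+1), phi^(m+1)(k + .)> = (-1)^(m+1) phi(k).
*)

theory Submission imports Defs "HOL-Complex_Analysis.Complex_Analysis" begin

section \<open>Schwartz functions\<close>

text \<open>If \<open>Re z\<close> is an integer, then \<open>m - z\<close> has real part 0, where
  the integral for the kernel need not converge absolutely at the origin, and for an integer
  \<open>z\<close> the kernel is the Dirac mass. Spending one further derivative on
  \<open>K (m - z)\<close> from the start treats all \<open>z\<close> alike and keeps every integral
  absolutely convergent. The second obstacle is that the pairing of \<open>K w\<close> with \<phi>(x
  + .), as a function of x, decays towards plus infinity but not necessarily towards minus infinity,
  so it may leave the Schwartz space. The integral identities are therefore proved for the wider
  class \<open>rapidly_decreasing\<close>, with decay on the half-line only, while derivatives in x
  are taken at every real x. The class also contains exp (- t), the test function from which the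
  Beta integral is computed. Continuity of the fractional derivative on \<open>Psi_plus\<close> is
  not estimated directly: it is inherited from the Dirac series once the two functionals
  agree.\<close>

lemma nderiv_0 [simp]: "nderiv 0 f = f"
  by (simp add: nderiv_def)

lemma nderiv_Suc: "nderiv (Suc n) f = (\<lambda>x. vector_derivative (nderiv n f) (at x))"
  by (simp add: nderiv_def)

lemma nderiv_nderiv: "nderiv n (nderiv k f) = nderiv (n + k) f"
  by (simp add: nderiv_def funpow_add)

lemma smooth_nderiv: "smooth f \<Longrightarrow> smooth (nderiv k f)"
  by (simp add: smooth_def nderiv_nderiv)

lemma has_vector_derivative_nderiv:
  "smooth f \<Longrightarrow> (nderiv n f has_vector_derivative nderiv (Suc n) f x) (at x)"
  by (simp add: smooth_def nderiv_Suc vector_derivative_works[symmetric])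

lemma continuous_on_nderiv: "smooth f \<Longrightarrow> continuous_on A (nderiv n f)"
  by (intro continuous_at_imp_continuous_on ballI has_vector_derivative_continuous
        [OF has_vector_derivative_nderiv])

lemma borel_measurable_smooth: "smooth f \<Longrightarrow> f \<in> borel_measurable borel"
  using continuous_on_nderiv[of f UNIV 0] by (intro borel_measurable_continuous_onI) simp

text \<open>Since \<open>nderiv\<close> iterates a pointwise operator, guessing the whole tower of
  derivatives identifies all of them in one induction. Iterated derivatives below are computed
  through such towers.\<close>

lemma nderiv_eqI:
  assumes "\<And>n x. (F n has_vector_derivative F (Suc n) x) (at x)"
  shows "nderiv n (F 0) = F n"
proof (induction n)
  case (Suc n)
  then show ?case
    using vector_derivative_at[OF assms] by (simp add: nderiv_Suc)
qed simp

lemma smoothI: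
  assumes "\<And>n x. (F n has_vector_derivative F (Suc n) x) (at x)"
  shows "smooth (F 0)"
  unfolding smooth_def nderiv_eqI[of F, OF assms]
  using assms differentiableI_vector by blast

lemma translate_tower:
  assumes "smooth f"
  shows "((\<lambda>y. nderiv n f (x + y)) has_vector_derivative nderiv (Suc n) f (x + y)) (at y)"
proof -
  have "((\<lambda>y. x + y) has_vector_derivative 1) (at y)"
    by (auto intro!: derivative_eq_intros)
  from vector_diff_chain_at[OF this has_vector_derivative_nderiv[OF assms]]
  show ?thesis
    by (simp add: o_def)
qed

lemma nderiv_translate:
  "smooth f \<Longrightarrow> nderiv n (\<lambda>y. f (x + y)) = (\<lambda>y. nderiv n f (x + y))"
  using nderiv_eqI[of "\<lambda>n y. nderiv n f (x + y)", OF translate_tower] by simp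

lemma smooth_translate: "smooth f \<Longrightarrow> smooth (\<lambda>y. f (x + y))"
  using smoothI[of "\<lambda>n y. nderiv n f (x + y)", OF translate_tower] by simp

lemma lincomb_tower:
  assumes "smooth f" "smooth g"
  shows "((\<lambda>x. c * nderiv n f x + d * nderiv n g x) has_vector_derivative
           c * nderiv (Suc n) f x + d * nderiv (Suc n) g x) (at x)"
  by (intro derivative_intros has_vector_derivative_nderiv assms)

lemma nderiv_lincomb:
  "smooth f \<Longrightarrow> smooth g \<Longrightarrow>
    nderiv n (\<lambda>x. c * f x + d * g x) = (\<lambda>x. c * nderiv n f x + d * nderiv n g x)"
  using nderiv_eqI[of "\<lambda>n x. c * nderiv n f x + d * nderiv n g x", OF lincomb_tower] by simp

lemma smooth_lincomb: "smooth f \<Longrightarrow> smooth g \<Longrightarrow> smooth (\<lambda>x. c * f x + d * g x)"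
  using smoothI[of "\<lambda>n x. c * nderiv n f x + d * nderiv n g x", OF lincomb_tower] by simp

section \<open>Seminorms and decay of Schwartz functions\<close>

lemma schwartz_spaceD_smooth: "\<phi> \<in> schwartz_space X \<Longrightarrow> smooth \<phi>"
  by (simp add: schwartz_space_def)

lemma schwartz_space_antimono: "X \<subseteq> Y \<Longrightarrow> schwartz_space Y \<subseteq> schwartz_space X"
  unfolding schwartz_space_def
  by (intro Collect_mono impI conjI allI) (simp, meson bdd_above_mono image_mono)

lemma le_schwartz_seminorm:
  assumes "\<phi> \<in> schwartz_space X" "x \<in> X"
  shows "\<bar>x\<bar> ^ n * cmod (nderiv m \<phi> x) \<le> schwartz_seminorm X n m \<phi>"
  using assms unfolding schwartz_space_def schwartz_seminorm_def by (auto intro: cSUP_upper)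

lemma one_plus_power_le: "0 \<le> (a::real) \<Longrightarrow> (1 + a) ^ N \<le> 2 ^ N * (1 + a ^ N)"
proof -
  assume a: "0 \<le> a"
  have "(1 + a) ^ N \<le> (2 * max 1 a) ^ N"
    using a by (intro power_mono) auto
  also have "\<dots> = 2 ^ N * max 1 a ^ N"
    by (simp add: power_mult_distrib)
  also have "max 1 a ^ N \<le> 1 + a ^ N"
    using a by (auto simp: max_def)
  finally show ?thesis by simp
qed

text \<open>The weight \<open>\<bar>x\<bar> ^ N\<close> of a single seminorm gives no control near
  0. Orders 0 and N together give the weight \<open>(1 + \<bar>x\<bar>) ^ N\<close>, the form in
  which decay enters the integral estimates.\<close>

lemma schwartz_seminorm_decay:
  assumes "\<phi> \<in> schwartz_space X" "x \<in> X"
  shows "(1 + \<bar>x\<bar>) ^ N * cmod (nderiv m \<phi> x)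
           \<le> 2 ^ N * (schwartz_seminorm X 0 m \<phi> + schwartz_seminorm X N m \<phi>)"
proof -
  have "(1 + \<bar>x\<bar>) ^ N * cmod (nderiv m \<phi> x) \<le> (2 ^ N * (1 + \<bar>x\<bar> ^ N)) * cmod (nderiv m \<phi> x)"
    by (intro mult_right_mono one_plus_power_le) auto
  also have "\<dots> = 2 ^ N * (\<bar>x\<bar> ^ 0 * cmod (nderiv m \<phi> x) + \<bar>x\<bar> ^ N * cmod (nderiv m \<phi> x))"
    by (simp add: algebra_simps)
  also have "\<dots> \<le> 2 ^ N * (schwartz_seminorm X 0 m \<phi> + schwartz_seminorm X N m \<phi>)"
    by (intro mult_left_mono add_mono le_schwartz_seminorm assms) auto
  finally show ?thesis .
qed

lemma schwartz_spaceI: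
  assumes "smooth \<phi>" "\<And>n m. \<exists>C. \<forall>x\<in>X. \<bar>x\<bar> ^ n * cmod (nderiv m \<phi> x) \<le> C"
  shows "\<phi> \<in> schwartz_space X"
  using assms unfolding schwartz_space_def bdd_above_def by fastforce

lemma schwartz_space_decay:
  assumes "\<phi> \<in> schwartz_space X"
  obtains C where "\<And>x. x \<in> X \<Longrightarrow> (1 + \<bar>x\<bar>) ^ N * cmod (nderiv m \<phi> x) \<le> C"
  using schwartz_seminorm_decay[OF assms] by blast

lemma schwartz_space_nderiv: "\<phi> \<in> schwartz_space X \<Longrightarrow> nderiv k \<phi> \<in> schwartz_space X"
  by (simp add: schwartz_space_def smooth_nderiv nderiv_nderiv)

lemma schwartz_space_translate:
  assumes "\<phi> \<in> schwartz_space UNIV"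
  shows "(\<lambda>y. \<phi> (x + y)) \<in> schwartz_space UNIV"
proof (rule schwartz_spaceI)
  note smooth = schwartz_spaceD_smooth[OF assms]
  show "smooth (\<lambda>y. \<phi> (x + y))"
    by (rule smooth_translate[OF smooth])
  fix n m
  obtain C where C: "(1 + \<bar>u\<bar>) ^ n * cmod (nderiv m \<phi> u) \<le> C" for u
    using schwartz_space_decay[OF assms] by (metis UNIV_I)
  have "\<bar>y\<bar> ^ n * cmod (nderiv m (\<lambda>y. \<phi> (x + y)) y) \<le> (1 + \<bar>x\<bar>) ^ n * C" for y
  proof -
    \<comment> \<open>Peetre's inequality: a weight at y costs the factor
      \<open>1 + \<bar>x\<bar>\<close> when it is moved to x + y.\<close>
    have "\<bar>y\<bar> \<le> 1 + \<bar>x\<bar> + \<bar>x + y\<bar> + \<bar>x\<bar> * \<bar>x + y\<bar>"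
      by (rule order.trans[of _ "1 + \<bar>x\<bar> + \<bar>x + y\<bar>"]) auto
    then have "\<bar>y\<bar> \<le> (1 + \<bar>x\<bar>) * (1 + \<bar>x + y\<bar>)"
      by (simp add: algebra_simps)
    then have "\<bar>y\<bar> ^ n * cmod (nderiv m \<phi> (x + y))
        \<le> ((1 + \<bar>x\<bar>) * (1 + \<bar>x + y\<bar>)) ^ n * cmod (nderiv m \<phi> (x + y))"
      by (intro mult_right_mono power_mono) auto
    also have "\<dots> = (1 + \<bar>x\<bar>) ^ n * ((1 + \<bar>x + y\<bar>) ^ n * cmod (nderiv m \<phi> (x + y)))"
      by (simp add: power_mult_distrib mult_ac)
    also have "\<dots> \<le> (1 + \<bar>x\<bar>) ^ n * C"
      by (intro mult_left_mono C) auto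
    finally show ?thesis
      by (simp add: nderiv_translate[OF smooth])
  qed
  then show "\<exists>C. \<forall>y\<in>UNIV. \<bar>y\<bar> ^ n * cmod (nderiv m (\<lambda>y. \<phi> (x + y)) y) \<le> C"
    by blast
qed

lemma schwartz_space_lincomb:
  assumes "f \<in> schwartz_space X" "g \<in> schwartz_space X"
  shows "(\<lambda>x. c * f x + d * g x) \<in> schwartz_space X"
proof (rule schwartz_spaceI)
  note smooth = assms[THEN schwartz_spaceD_smooth]
  show "smooth (\<lambda>x. c * f x + d * g x)"
    by (rule smooth_lincomb[OF smooth])
  fix n m
  have "\<bar>x\<bar> ^ n * cmod (nderiv m (\<lambda>x. c * f x + d * g x) x)
      \<le> cmod c * schwartz_seminorm X n m f + cmod d * schwartz_seminorm X n m g" if "x \<in> X" for x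
  proof -
    have "\<bar>x\<bar> ^ n * cmod (c * nderiv m f x + d * nderiv m g x)
        \<le> \<bar>x\<bar> ^ n * (cmod c * cmod (nderiv m f x) + cmod d * cmod (nderiv m g x))"
      by (intro mult_left_mono order.trans[OF norm_triangle_ineq]) (auto simp: norm_mult)
    also have "\<dots> = cmod c * (\<bar>x\<bar> ^ n * cmod (nderiv m f x))
        + cmod d * (\<bar>x\<bar> ^ n * cmod (nderiv m g x))"
      by (simp add: algebra_simps)
    also have "\<dots> \<le> cmod c * schwartz_seminorm X n m f + cmod d * schwartz_seminorm X n m g"
      by (intro add_mono mult_left_mono le_schwartz_seminorm assms that) auto
    finally show ?thesis
      by (simp add: nderiv_lincomb[OF smooth])
  qed
  then show "\<exists>C. \<forall>x\<in>X. \<bar>x\<bar> ^ n * cmod (nderiv m (\<lambda>x. c * f x + d * g x) x) \<le> C"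
    by blast
qed

section \<open>Functionals in the topological dual\<close>

text \<open>The topology is known only through its subbasis of seminorm balls. A point of a preimage
  gets the neighbourhood formed by the two balls whose seminorms occur in the bound, cut down to
  \<open>V\<close>. Keeping \<open>V\<close> apart from the full space lets the same bound serve
  \<open>Psi_plus\<close>.\<close>

lemma topological_dualI:
  assumes X: "X \<noteq> {}" and V: "V \<subseteq> schwartz_space X"
    and linear: "linear_functional_on (schwartz_space X) T"
    and bound: "\<And>\<phi>. \<phi> \<in> schwartz_space X \<Longrightarrow>
        cmod (T \<phi>) \<le> C * (schwartz_seminorm X 0 0 \<phi> + schwartz_seminorm X N 0 \<phi>)"
  shows "T \<in> topological_dual (schwartz_topology X) V"
proof -
  define U where "U = (\<lambda>n \<phi> \<epsilon>. {\<psi> \<in> schwartz_space X. schwartz_seminorm X n 0 (\<lambda>x. \<psi> x - \<phi> x) < \<epsilon>})"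
  have open_U: "openin (schwartz_topology X) (U n \<phi> \<epsilon>)"
    if "\<phi> \<in> schwartz_space X" "\<epsilon> > 0" for n \<phi> \<epsilon>
    unfolding schwartz_topology_def U_def using that
    by (intro topology_generated_by_Basis) blast
  \<comment> \<open>A ball contains its centre because the supremum of the constant 0 over a
    nonempty \<open>X\<close> is 0; over the empty set \<open>SUP\<close> is an unspecified
    real.\<close>
  have mem_U: "\<phi> \<in> U n \<phi> \<epsilon>" if "\<phi> \<in> schwartz_space X" "\<epsilon> > 0" for n \<phi> \<epsilon>
    using that X by (simp add: U_def schwartz_seminorm_def)
  have "continuous_map (subtopology (schwartz_topology X) V) euclidean T"
    unfolding continuous_map_def
  proof (intro conjI allI impI)
    fix S :: "complex set" assume S: "openin euclidean S"
    let ?A = "{\<phi> \<in> topspace (subtopology (schwartz_topology X) V). T \<phi> \<in> S}"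
    have "\<exists>W. openin (subtopology (schwartz_topology X) V) W \<and> \<phi> \<in> W \<and> W \<subseteq> ?A" if "\<phi> \<in> ?A" for \<phi>
    proof -
      have \<phi>: "\<phi> \<in> schwartz_space X" "\<phi> \<in> V" "T \<phi> \<in> S"
        using that V by auto
      obtain e where e: "e > 0" "ball (T \<phi>) e \<subseteq> S"
        using S \<phi>(3) by (auto simp: open_contains_ball)
      \<comment> \<open>\<open>\<bar>C\<bar> + 1\<close> keeps the quotient defined for C = 0 and
        makes the final estimate strict.\<close>
      define \<epsilon> where "\<epsilon> = e / (2 * (\<bar>C\<bar> + 1))"
      have \<epsilon>: "\<epsilon> > 0" using e by (simp add: \<epsilon>_def)
      define W where "W = (U 0 \<phi> \<epsilon> \<inter> U N \<phi> \<epsilon>) \<inter> V"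
      have "T \<psi> \<in> S" if "\<psi> \<in> W" for \<psi>
      proof -
        have \<psi>: "\<psi> \<in> schwartz_space X"
          and small: "schwartz_seminorm X 0 0 (\<lambda>x. \<psi> x - \<phi> x) < \<epsilon>"
            "schwartz_seminorm X N 0 (\<lambda>x. \<psi> x - \<phi> x) < \<epsilon>"
          using that by (auto simp: W_def U_def)
        have diff: "(\<lambda>x. \<psi> x - \<phi> x) = (\<lambda>x. 1 * \<psi> x + (-1) * \<phi> x)"
          by simp
        have mem: "(\<lambda>x. \<psi> x - \<phi> x) \<in> schwartz_space X"
          unfolding diff by (intro schwartz_space_lincomb \<phi> \<psi>)
        obtain x0 where x0: "x0 \<in> X" using X by blast
        have nonneg: "0 \<le> schwartz_seminorm X n 0 (\<lambda>x. \<psi> x - \<phi> x)" for n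
          by (rule order.trans[OF _ le_schwartz_seminorm[OF mem x0]]) simp
        have "T (\<lambda>x. 1 * \<psi> x + (-1) * \<phi> x) = 1 * T \<psi> + (-1) * T \<phi>"
          using linear \<phi>(1) \<psi> unfolding linear_functional_on_def by blast
        then have "T \<psi> - T \<phi> = T (\<lambda>x. \<psi> x - \<phi> x)"
          by simp
        then have "cmod (T \<psi> - T \<phi>) \<le> C * (schwartz_seminorm X 0 0 (\<lambda>x. \<psi> x - \<phi> x)
            + schwartz_seminorm X N 0 (\<lambda>x. \<psi> x - \<phi> x))"
          using bound[OF mem] by simp
        also have "\<dots> \<le> \<bar>C\<bar> * (\<epsilon> + \<epsilon>)"
          using small nonneg by (intro mult_mono add_mono) (auto intro: add_nonneg_nonneg)
        also have "\<dots> < (\<bar>C\<bar> + 1) * (2 * \<epsilon>)"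
          using \<epsilon> by simp
        also have "\<dots> = e"
          by (simp add: \<epsilon>_def field_simps)
        finally show ?thesis
          using e(2) by (auto simp: dist_norm norm_minus_commute)
      qed
      moreover have "openin (subtopology (schwartz_topology X) V) W"
        unfolding W_def openin_subtopology using \<phi> \<epsilon> open_U
        by (intro exI[of _ "U 0 \<phi> \<epsilon> \<inter> U N \<phi> \<epsilon>"] conjI openin_Int refl)
      moreover have "\<phi> \<in> W"
        using \<phi> \<epsilon> mem_U by (auto simp: W_def)
      ultimately show ?thesis
        using openin_subset by (intro exI[of _ W]) blast
    qed
    then show "openin (subtopology (schwartz_topology X) V) ?A"
      by (subst openin_subopen) blast
  qed auto
  moreover have "linear_functional_on V T"
    using linear V unfolding linear_functional_on_def by blast
  ultimately show ?thesis
    by (simp add: topological_dual_def)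
qed

text \<open>Transfers continuity and linearity between total functions that agree where it matters.
  Agreement on linear combinations is a separate premise because \<open>V\<close> is not assumed
  closed under them.\<close>

lemma topological_dual_cong:
  assumes "S \<in> topological_dual \<tau> V" "\<And>\<phi>. \<phi> \<in> V \<Longrightarrow> T \<phi> = S \<phi>"
    and "\<And>\<phi> \<psi> c d. \<phi> \<in> V \<Longrightarrow> \<psi> \<in> V \<Longrightarrow> T (\<lambda>x. c * \<phi> x + d * \<psi> x) = S (\<lambda>x. c * \<phi> x + d * \<psi> x)"
  shows "T \<in> topological_dual \<tau> V"
  using assms unfolding topological_dual_def linear_functional_on_def
  by (auto intro: continuous_map_eq)

section \<open>Integrals against truncated powers\<close>

text \<open>Weak enough to be preserved by translation to the right and by the inner integral of a
  convolution, and to admit exp (- t), which grows at minus infinity; strong enough to pair with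
  every truncated power of exponent above -1.\<close>

definition rapidly_decreasing :: "(real \<Rightarrow> complex) \<Rightarrow> bool" where
  "rapidly_decreasing f \<longleftrightarrow>
     f \<in> borel_measurable borel \<and> (\<forall>N. \<exists>C. \<forall>t\<ge>0. (1 + t) ^ N * cmod (f t) \<le> C)"

lemma rapidly_decreasingD_measurable: "rapidly_decreasing f \<Longrightarrow> f \<in> borel_measurable borel"
  by (simp add: rapidly_decreasing_def)

lemma rapidly_decreasingE:
  assumes "rapidly_decreasing f"
  obtains C where "C \<ge> 0" "\<And>t. t \<ge> 0 \<Longrightarrow> (1 + t) ^ N * cmod (f t) \<le> C"
proof -
  obtain C where C: "\<And>t. t \<ge> 0 \<Longrightarrow> (1 + t) ^ N * cmod (f t) \<le> C"
    using assms unfolding rapidly_decreasing_def by blast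
  moreover have "C \<ge> 0"
    using C[of 0] by (rule order.trans[rotated]) auto
  ultimately show ?thesis using that by blast
qed

lemma rapidly_decreasing_schwartz:
  assumes "\<phi> \<in> schwartz_space {0..}"
  shows "rapidly_decreasing \<phi>"
  unfolding rapidly_decreasing_def
proof (intro conjI allI)
  show "\<phi> \<in> borel_measurable borel"
    by (rule borel_measurable_smooth[OF schwartz_spaceD_smooth[OF assms]])
  fix N
  show "\<exists>C. \<forall>t\<ge>0. (1 + t) ^ N * cmod (\<phi> t) \<le> C"
    using schwartz_space_decay[OF assms, of N 0] by (metis abs_of_nonneg atLeast_iff nderiv_0)
qed

lemma rapidly_decreasing_translate:
  assumes "rapidly_decreasing f" "x \<ge> 0"
  shows "rapidly_decreasing (\<lambda>y. f (x + y))"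
  unfolding rapidly_decreasing_def
proof (intro conjI allI)
  show "(\<lambda>y. f (x + y)) \<in> borel_measurable borel"
    using rapidly_decreasingD_measurable[OF assms(1)] by measurable
  fix N
  obtain C where C: "\<And>t. t \<ge> 0 \<Longrightarrow> (1 + t) ^ N * cmod (f t) \<le> C"
    using rapidly_decreasingE[OF assms(1)] by metis
  have "(1 + t) ^ N * cmod (f (x + t)) \<le> C" if "t \<ge> 0" for t
  proof -
    have "(1 + t) ^ N * cmod (f (x + t)) \<le> (1 + (x + t)) ^ N * cmod (f (x + t))"
      using that assms(2) by (intro mult_right_mono power_mono) auto
    also have "\<dots> \<le> C"
      using that assms(2) by (intro C) auto
    finally show ?thesis .
  qed
  then show "\<exists>C. \<forall>t\<ge>0. (1 + t) ^ N * cmod (f (x + t)) \<le> C"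
    by blast
qed

text \<open>In this form measurability in t and holomorphy in w can be read off directly.\<close>

lemma truncated_power_eq_exp:
  "truncated_power t w = (if t > 0 then exp (w * of_real (ln t)) else 0)"
  by (simp add: truncated_power_def powr_def Ln_of_real)

lemma borel_measurable_truncated_power [measurable]:
  assumes [measurable]: "f \<in> borel_measurable M"
  shows "(\<lambda>x. truncated_power (f x) w) \<in> borel_measurable M"
  unfolding truncated_power_eq_exp by measurable

lemma cmod_truncated_power:
  "cmod (truncated_power t w) = indicator {0<..} t * t powr Re w"
  by (simp add: truncated_power_def norm_powr_real_powr)

lemma truncated_power_mult:
  "u > 0 \<Longrightarrow> truncated_power (u * r) w = truncated_power u w * truncated_power r w"
  by (auto simp: truncated_power_eq_exp ln_mult zero_less_mult_iff algebra_simps simp flip: exp_add)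

text \<open>Near 0 the exponent a - 1 exceeds -1; beyond 1 the bound on \<open>N\<close> pushes the
  exponent down to at most -2.\<close>

lemma integrable_powr_decay:
  assumes "a > 0" "real N \<ge> a + 1"
  shows "integrable lborel (\<lambda>t::real. indicator {0<..} t * (t powr (a - 1) / (1 + t) ^ N))"
proof (rule Bochner_Integration.integrable_bound)
  have "(\<lambda>t. t powr (a - 1)) absolutely_integrable_on {0..1}"
    using assms by (intro nonnegative_absolutely_integrable_1 integrable_on_powr_from_0) auto
  moreover have "(\<lambda>t::real. t powr (-2)) absolutely_integrable_on {1..}"
    using has_integral_powr_to_inf[of "-2" 1]
    by (intro nonnegative_absolutely_integrable_1) (auto simp: integrable_on_def)
  ultimately show "integrable lborel (\<lambda>t::real. indicator {0..1} t * t powr (a - 1)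
      + indicator {1..} t * t powr (-2))"
    by (intro Bochner_Integration.integrable_add)
       (simp_all add: set_integrable_def integrable_completion)
  have "norm (indicator {0<..} t * (t powr (a - 1) / (1 + t) ^ N))
      \<le> norm (indicator {0..1} t * t powr (a - 1) + indicator {1..} t * t powr (-2))" for t :: real
  proof -
    consider "t \<le> 0" | "0 < t" "t < 1" | "1 \<le> t" by linarith
    then show ?thesis
    proof cases
      case 2
      have "t powr (a - 1) / (1 + t) ^ N \<le> t powr (a - 1) / 1"
        using 2 by (intro divide_left_mono) auto
      then show ?thesis using 2 by simp
    next
      case 3
      have "t powr (a - 1) / (1 + t) ^ N \<le> t powr (a - 1) / t powr real N"
        using 3 by (intro divide_left_mono) (auto simp: powr_realpow intro!: power_mono)
      also have "\<dots> = t powr (a - 1 - real N)"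
        by (simp add: powr_diff)
      also have "\<dots> \<le> t powr (-2)"
        using 3 assms by (intro powr_mono) auto
      also have "\<dots> \<le> norm (indicator {0..1} t * t powr (a - 1) + indicator {1..} t * t powr (-2))"
        using 3 by (auto simp: indicator_def)
      finally show ?thesis using 3 by simp
    qed auto
  qed
  then show "AE t in lborel. norm (indicator {0<..} t * (t powr (a - 1) / (1 + t) ^ N))
      \<le> norm (indicator {0..1} t * t powr (a - 1) + indicator {1..} t * t powr (-2))"
    by simp
qed measurable

text \<open>Two exponents, so that one function dominates for all \<open>v\<close> in the strip
  \<open>a \<le> Re v \<le> b\<close>.\<close>

definition powr_dominator :: "real \<Rightarrow> real \<Rightarrow> nat \<Rightarrow> real \<Rightarrow> real" where
  "powr_dominator a b N t =
     indicator {0<..} t * (t powr (a - 1) / (1 + t) ^ N) + indicator {0<..} t * (t powr (b - 1) / (1 + t) ^ N)"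

lemma integrable_powr_dominator:
  "0 < a \<Longrightarrow> a \<le> b \<Longrightarrow> real N \<ge> b + 1 \<Longrightarrow> integrable lborel (powr_dominator a b N)"
  unfolding powr_dominator_def[abs_def]
  by (intro Bochner_Integration.integrable_add integrable_powr_decay) auto

text \<open>The power with exponent a - 1 dominates on (0, 1], the one with b - 1 beyond 1.
  \<open>c\<close> is a single number, so values of f, values of a translate and difference
  quotients can all be inserted for it.\<close>

lemma truncated_power_mult_le_dominator:
  assumes "a \<le> Re v" "Re v \<le> b" "t > 0 \<Longrightarrow> (1 + t) ^ N * cmod c \<le> C"
  shows "cmod (truncated_power t (v - 1) * c) \<le> C * powr_dominator a b N t"
proof (cases "t > 0")
  case True
  have "t powr (Re v - 1) \<le> t powr (a - 1) + t powr (b - 1)"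
  proof (cases "t \<le> 1")
    case le: True
    have "t powr (Re v - 1) \<le> t powr (a - 1)"
      using True le assms by (intro powr_mono') auto
    then show ?thesis by (simp add: add_increasing2)
  next
    case False
    have "t powr (Re v - 1) \<le> t powr (b - 1)"
      using False assms by (intro powr_mono) auto
    then show ?thesis by (simp add: add_increasing)
  qed
  moreover have "cmod c \<le> C / (1 + t) ^ N"
    using assms(3) True by (simp add: field_simps)
  ultimately have "t powr (Re v - 1) * cmod c
      \<le> (t powr (a - 1) + t powr (b - 1)) * (C / (1 + t) ^ N)"
    by (intro mult_mono) auto
  then show ?thesis
    using True by (simp add: norm_mult cmod_truncated_power powr_dominator_def field_simps)
qed (simp add: truncated_power_def powr_dominator_def)

lemma integrable_truncated_power_mult:
  assumes "Re v > 0" "rapidly_decreasing f"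
  shows "integrable lborel (\<lambda>t. truncated_power t (v - 1) * f t)"
proof -
  note [measurable] = rapidly_decreasingD_measurable[OF assms(2)]
  define N where "N = nat \<lceil>Re v + 1\<rceil>"
  obtain C where C: "\<And>t. t \<ge> 0 \<Longrightarrow> (1 + t) ^ N * cmod (f t) \<le> C"
    using rapidly_decreasingE[OF assms(2)] by metis
  show ?thesis
  proof (rule Bochner_Integration.integrable_bound)
    show "integrable lborel (\<lambda>t. C * powr_dominator (Re v) (Re v) N t)"
      using assms unfolding N_def
      by (intro integrable_mult_right integrable_powr_dominator) (auto intro: real_nat_ceiling_ge)
    show "AE t in lborel. norm (truncated_power t (v - 1) * f t)
        \<le> norm (C * powr_dominator (Re v) (Re v) N t)"
    proof (rule AE_I2)
      fix t
      have "cmod (truncated_power t (v - 1) * f t) \<le> C * powr_dominator (Re v) (Re v) N t"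
        by (rule truncated_power_mult_le_dominator) (use C in auto)
      then show "norm (truncated_power t (v - 1) * f t) \<le> norm (C * powr_dominator (Re v) (Re v) N t)"
        by simp
    qed
  qed measurable
qed

section \<open>Limits and holomorphy under the integral sign\<close>

text \<open>Dominated convergence along a filter: first countability reduces it to sequences, whose
  first k terms are dropped because the domination holds only eventually. It serves complex
  difference quotients in the exponent as well as real ones in the translation.\<close>

lemma tendsto_integral_at:
  fixes q :: "'p::first_countable_topology \<Rightarrow> 'a \<Rightarrow> 'b::{banach, second_countable_topology}"
  assumes ev: "eventually (\<lambda>h. q h \<in> borel_measurable M \<and> (\<forall>t\<in>space M. norm (q h t) \<le> g t)) (at p)"
    and g: "integrable M g"
    and lim: "\<And>t. t \<in> space M \<Longrightarrow> ((\<lambda>h. q h t) \<longlongrightarrow> d t) (at p)"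
  shows "((\<lambda>h. integral\<^sup>L M (q h)) \<longlongrightarrow> integral\<^sup>L M d) (at p)"
  unfolding tendsto_at_iff_sequentially
proof (intro allI impI)
  fix X assume X: "\<forall>i. X i \<in> UNIV - {p}" "X \<longlonglongrightarrow> p"
  then have X': "filterlim X (at p) sequentially"
    by (simp add: filterlim_at)
  obtain k where k: "\<And>i. i \<ge> k \<Longrightarrow>
      q (X i) \<in> borel_measurable M \<and> (\<forall>t\<in>space M. norm (q (X i) t) \<le> g t)"
    using eventually_compose_filterlim[OF ev X'] by (auto simp: eventually_sequentially)
  have lim': "(\<lambda>i. q (X (i + k)) t) \<longlonglongrightarrow> d t" if "t \<in> space M" for t
    using LIMSEQ_ignore_initial_segment[OF filterlim_compose[OF lim[OF that] X']] .
  have "d \<in> borel_measurable M"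
    using k by (intro borel_measurable_LIMSEQ_metric[OF _ lim']) auto
  then have "(\<lambda>i. integral\<^sup>L M (q (X (i + k)))) \<longlonglongrightarrow> integral\<^sup>L M d"
    using k lim' g by (intro integral_dominated_convergence[where w = g]) (auto intro!: AE_I2)
  then show "((\<lambda>h. integral\<^sup>L M (q h)) \<circ> X) \<longlonglongrightarrow> integral\<^sup>L M d"
    unfolding o_def by (rule LIMSEQ_offset)
qed

text \<open>A bound on \<open>f v t\<close> suffices, because Cauchy's inequality turns it into a bound on the
  difference quotients.\<close>

lemma holomorphic_on_integral:
  fixes f :: "complex \<Rightarrow> 'a \<Rightarrow> complex"
  assumes S: "open S"
    and hol: "\<And>t. t \<in> space M \<Longrightarrow> (\<lambda>v. f v t) holomorphic_on S"
    and meas: "\<And>v. v \<in> S \<Longrightarrow> f v \<in> borel_measurable M"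
    and dom: "\<And>v\<^sub>0. v\<^sub>0 \<in> S \<Longrightarrow> \<exists>r>0. \<exists>g. integrable M g \<and>
                (\<forall>v\<in>ball v\<^sub>0 r. \<forall>t\<in>space M. cmod (f v t) \<le> g t)"
  shows "(\<lambda>v. integral\<^sup>L M (f v)) holomorphic_on S"
  unfolding holomorphic_on_open[OF S]
proof
  fix v assume v: "v \<in> S"
  obtain r g where r: "r > 0" and g: "integrable M g"
    and le_g: "\<And>w t. w \<in> ball v r \<Longrightarrow> t \<in> space M \<Longrightarrow> cmod (f w t) \<le> g t"
    using dom[OF v] by blast
  obtain e where e: "e > 0" "cball v e \<subseteq> S"
    using S v by (auto simp: open_contains_cball)
  \<comment> \<open>For w within s of v, the closed disc of radius s about w stays in
    \<open>cball v (2 * s)\<close>, hence in \<open>S\<close> and in the region where g dominates.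
    Using r / 2 fits a closed disc into the open ball.\<close>
  define s where "s = min e (r / 2) / 2"
  have s: "s > 0" and sub_S: "cball v (2 * s) \<subseteq> S" and sub_r: "cball v (2 * s) \<subseteq> ball v r"
    using e r by (auto simp: s_def min_def)
  have deriv_le: "cmod (deriv (\<lambda>v. f v t) w) \<le> g t / s" if "w \<in> ball v s" and t: "t \<in> space M" for w t
  proof -
    have sub: "cball w s \<subseteq> cball v (2 * s)"
    proof
      fix x assume "x \<in> cball w s"
      then show "x \<in> cball v (2 * s)"
        using that dist_triangle[of v x w] by auto
    qed
    have "cmod ((deriv ^^ 1) (\<lambda>v. f v t) w) \<le> fact 1 * g t / s ^ 1"
    proof (rule Cauchy_inequality)
      show "(\<lambda>v. f v t) holomorphic_on ball w s"
        by (rule holomorphic_on_subset[OF hol[OF t]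
              order.trans[OF ball_subset_cball order.trans[OF sub sub_S]]])
      show "continuous_on (cball w s) (\<lambda>v. f v t)"
        by (rule holomorphic_on_imp_continuous_on[OF holomorphic_on_subset[OF hol[OF t]
              order.trans[OF sub sub_S]]])
      show "cmod (f x t) \<le> g t" if "cmod (w - x) = s" for x
      proof -
        have "x \<in> cball w s"
          using that by (simp add: dist_norm)
        then show ?thesis
          by (intro le_g subsetD[OF sub_r] subsetD[OF sub] t)
      qed
    qed (use s in auto)
    then show ?thesis by simp
  qed
  have hfd: "((\<lambda>v. f v t) has_field_derivative deriv (\<lambda>v. f v t) w) (at w)"
    if "w \<in> S" "t \<in> space M" for w t
    using holomorphic_derivI[OF hol[OF that(2)] S that(1)] .
  have "((\<lambda>h. integral\<^sup>L M (\<lambda>t. (f (v + h) t - f v t) / h)) \<longlongrightarrow> integral\<^sup>L M (\<lambda>t. deriv (\<lambda>v. f v t) v)) (at 0)"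
  proof (rule tendsto_integral_at)
    show "integrable M (\<lambda>t. g t / s)"
      using g by simp
    show "((\<lambda>h. (f (v + h) t - f v t) / h) \<longlongrightarrow> deriv (\<lambda>v. f v t) v) (at 0)" if "t \<in> space M" for t
      using hfd[OF v that] by (simp add: DERIV_def)
    have "eventually (\<lambda>h. h \<in> ball 0 s - {0}) (at 0)"
      using s by (intro eventually_at_in_open) auto
    then show "eventually (\<lambda>h. (\<lambda>t. (f (v + h) t - f v t) / h) \<in> borel_measurable M \<and>
        (\<forall>t\<in>space M. cmod ((f (v + h) t - f v t) / h) \<le> g t / s)) (at 0)"
    proof eventually_elim
      case (elim h)
      have vh: "v + h \<in> ball v s"
        using elim by (simp add: dist_norm)
      have "v + h \<in> S"
        using vh sub_S s by auto
      moreover have "cmod ((f (v + h) t - f v t) / h) \<le> g t / s" if t: "t \<in> space M" for t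
      proof -
        have "cmod (f (v + h) t - f v t) \<le> g t / s * cmod (v + h - v)"
        proof (rule field_differentiable_bound[where f' = "deriv (\<lambda>v. f v t)"])
          fix w assume w: "w \<in> ball v s"
          then have "w \<in> S"
            using sub_S s by auto
          then show "((\<lambda>v. f v t) has_field_derivative deriv (\<lambda>v. f v t) w) (at w within ball v s)"
            by (rule has_field_derivative_at_within[OF hfd[OF _ t]])
          show "cmod (deriv (\<lambda>v. f v t) w) \<le> g t / s"
            by (rule deriv_le[OF w t])
        qed (use vh s in auto)
        then show ?thesis
          using elim by (simp add: norm_divide pos_divide_le_eq)
      qed
      ultimately show ?case
        using meas v by auto
    qed
  qed
  moreover have "eventually (\<lambda>h. integral\<^sup>L M (\<lambda>t. (f (v + h) t - f v t) / h)
      = (integral\<^sup>L M (f (v + h)) - integral\<^sup>L M (f v)) / h) (at 0)"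
  proof -
    have int: "integrable M (f w)" if "w \<in> ball v s" for w
    proof (rule Bochner_Integration.integrable_bound[OF g])
      have w: "w \<in> cball v (2 * s)"
        using that s by auto
      show "f w \<in> borel_measurable M"
        by (intro meas subsetD[OF sub_S] w)
      show "AE t in M. norm (f w t) \<le> norm (g t)"
      proof (rule AE_I2)
        fix t assume "t \<in> space M"
        then have "cmod (f w t) \<le> g t"
          by (intro le_g subsetD[OF sub_r] w)
        then show "norm (f w t) \<le> norm (g t)"
          by simp
      qed
    qed
    have "eventually (\<lambda>h. h \<in> ball 0 s - {0}) (at 0)"
      using s by (intro eventually_at_in_open) auto
    then show ?thesis
    proof eventually_elim
      case (elim h)
      then show ?case
        using int[of v] int[of "v + h"] s by (simp add: dist_norm)
    qed
  qed
  ultimately show "\<exists>D. ((\<lambda>v. integral\<^sup>L M (f v)) has_field_derivative D) (at v)"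
    unfolding DERIV_def by (intro exI) (rule Lim_transform_eventually)
qed

section \<open>Integration by parts on the half-line\<close>

lemma smooth_has_vector_derivative: "smooth \<phi> \<Longrightarrow> (\<phi> has_vector_derivative nderiv 1 \<phi> t) (at t)"
  using has_vector_derivative_nderiv[of \<phi> 0 t] by simp

lemma rapidly_decreasing_tendsto_0:
  assumes "rapidly_decreasing f"
  shows "((\<lambda>t. of_real t powr v * f t) \<longlongrightarrow> 0) at_top"
proof -
  define N where "N = nat \<lceil>Re v + 1\<rceil>"
  obtain C where C: "C \<ge> 0" "\<And>t. t \<ge> 0 \<Longrightarrow> (1 + t) ^ N * cmod (f t) \<le> C"
    using rapidly_decreasingE[OF assms] by metis
  have "cmod (of_real t powr v * f t) \<le> C * t powr (-1)" if t: "t \<ge> 1" for t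
  proof -
    have "t powr (Re v + 1) \<le> t powr real N"
      unfolding N_def using t by (intro powr_mono real_nat_ceiling_ge) auto
    also have "\<dots> \<le> (1 + t) ^ N"
      using t by (auto simp: powr_realpow intro!: power_mono)
    finally have "t powr (Re v + 1) * cmod (f t) \<le> (1 + t) ^ N * cmod (f t)"
      by (rule mult_right_mono) simp
    also have "\<dots> \<le> C"
      using t by (intro C) auto
    finally have "t powr (-1) * (t powr (Re v + 1) * cmod (f t)) \<le> t powr (-1) * C"
      by (rule mult_left_mono) simp
    moreover have "t powr (-1) * t powr (Re v + 1) = t powr Re v"
      using t by (simp add: powr_add powr_minus_divide)
    moreover have "cmod (of_real t powr v * f t) = t powr Re v * cmod (f t)"
      using t by (simp add: norm_mult norm_powr_real_powr)
    ultimately show ?thesis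
      by (metis mult.assoc mult.commute)
  qed
  then have "eventually (\<lambda>t. cmod (of_real t powr v * f t) \<le> C * t powr (-1)) at_top"
    unfolding eventually_at_top_linorder by blast
  moreover have "((\<lambda>t. C * t powr (-1)) \<longlongrightarrow> 0) at_top"
    by (intro tendsto_mult_right_zero tendsto_neg_powr filterlim_ident) auto
  ultimately show ?thesis
    by (rule Lim_null_comparison)
qed

text \<open>The fundamental theorem of calculus for t^v \<phi>(t) on (0, \<infinity>): a positive
  real part of v kills the boundary term at 0, rapid decay the one at infinity.\<close>

lemma truncated_power_integral_by_parts:
  assumes \<phi>: "\<phi> \<in> schwartz_space {0..}" and v: "Re v > 0"
  shows "v * (LINT t|lborel. truncated_power t (v - 1) * \<phi> t)
           = - (LINT t|lborel. truncated_power t v * nderiv 1 \<phi> t)"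
proof -
  note smooth = schwartz_spaceD_smooth[OF \<phi>]
  note rd = rapidly_decreasing_schwartz[OF \<phi>]
    rapidly_decreasing_schwartz[OF schwartz_space_nderiv[OF \<phi>, of 1]]
  define h where "h = (\<lambda>t::real. v * of_real t powr (v - 1) * \<phi> t + of_real t powr v * nderiv 1 \<phi> t)"
  define H where "H = (\<lambda>t::real. of_real t powr v * \<phi> t)"
  have i1: "integrable lborel (\<lambda>t. v * (truncated_power t (v - 1) * \<phi> t))"
    by (intro integrable_mult_right integrable_truncated_power_mult v rd)
  have i2: "integrable lborel (\<lambda>t. truncated_power t v * nderiv 1 \<phi> t)"
    using integrable_truncated_power_mult[of "v + 1", OF _ rd(2)] v by simp
  have h_eq: "(\<lambda>t. indicator {0<..} t *\<^sub>R h t) = (\<lambda>t. v * (truncated_power t (v - 1) * \<phi> t)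
      + truncated_power t v * nderiv 1 \<phi> t)"
    by (auto simp: h_def truncated_power_def indicator_def fun_eq_iff)
  have dpowr: "((\<lambda>t. of_real t powr v) has_vector_derivative v * of_real t powr (v - 1)) (at t)"
    if "t > 0" for t :: real
    using has_field_derivative_powr[of "of_real t" v] that
    by (intro has_vector_derivative_real_field) (auto simp: complex_nonpos_Reals_iff mult.commute)
  have "(LBINT t=0..\<infinity>. h t) = 0 - 0"
  proof (rule interval_integral_FTC_integrable[where F = H])
    fix t assume "0 < ereal t"
    then have t: "t > 0" by simp
    show "(H has_vector_derivative h t) (at t)"
      unfolding H_def h_def
      using has_vector_derivative_mult[OF dpowr[OF t] smooth_has_vector_derivative[OF smooth]]
      by (simp add: add.commute)
    have "continuous (at t) \<phi>" "continuous (at t) (nderiv 1 \<phi>)"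
      using continuous_on_nderiv[OF smooth, of UNIV 0] continuous_on_nderiv[OF smooth, of UNIV 1]
      by (auto simp: continuous_on_eq_continuous_at)
    then show "isCont h t"
      unfolding h_def using t
      by (intro continuous_intros isCont_powr_complex) auto
  next
    show "set_integrable lborel (einterval 0 \<infinity>) h"
      using Bochner_Integration.integrable_add[OF i1 i2]
      by (simp add: set_integrable_def h_eq zero_ereal_def)
    have "(H \<longlongrightarrow> 0) (at_right 0)"
    proof -
      have "(\<phi> \<longlongrightarrow> \<phi> 0) (at_right 0)"
        using has_vector_derivative_continuous[OF smooth_has_vector_derivative[OF smooth, of 0]]
        by (auto simp: continuous_at intro: tendsto_within_subset)
      moreover have "((\<lambda>t. of_real t powr v :: complex) \<longlongrightarrow> 0) (at_right 0)"
      proof (rule tendsto_norm_zero_cancel)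
        have "((\<lambda>t. t powr Re v) \<longlongrightarrow> 0 powr Re v) (at_right (0::real))"
          using v by (intro tendsto_powr')
            (auto intro!: tendsto_intros eventually_mono[OF eventually_at_right_less])
        moreover have "eventually (\<lambda>t. t powr Re v = cmod (of_real t powr v)) (at_right 0)"
          using eventually_at_right_less[of 0] by eventually_elim (simp add: norm_powr_real_powr)
        ultimately show "((\<lambda>t. cmod (of_real t powr v)) \<longlongrightarrow> 0) (at_right 0)"
          using v by (auto intro: Lim_transform_eventually)
      qed
      ultimately have "((\<lambda>t. of_real t powr v * \<phi> t) \<longlongrightarrow> 0 * \<phi> 0) (at_right 0)"
        by (intro tendsto_mult)
      then show ?thesis
        by (simp add: H_def)
    qed
    then show "((H \<circ> real_of_ereal) \<longlongrightarrow> 0) (at_right 0)"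
      by (simp add: zero_ereal_def ereal_tendsto_simps)
    show "((H \<circ> real_of_ereal) \<longlongrightarrow> 0) (at_left \<infinity>)"
      using rapidly_decreasing_tendsto_0[OF rd(1), of v]
      by (simp add: ereal_tendsto_simps H_def)
  qed simp
  then have "(LINT t|lborel. indicator {0<..} t *\<^sub>R h t) = 0"
    by (simp add: interval_lebesgue_integral_0_infty set_lebesgue_integral_def)
  then show ?thesis
    unfolding h_eq Bochner_Integration.integral_add[OF i1 i2] by (simp add: add_eq_0_iff2)
qed

text \<open>The limiting case v = 0, in which the boundary term at 0 survives. This is where point
  evaluations, and hence the Dirac masses, come from.\<close>

lemma integral_nderiv_half_line:
  assumes \<phi>: "\<phi> \<in> schwartz_space {0..}"
  shows "(LINT t|lborel. truncated_power t 0 * nderiv 1 \<phi> t) = - \<phi> 0"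
proof -
  note smooth = schwartz_spaceD_smooth[OF \<phi>]
  note rd = rapidly_decreasing_schwartz[OF \<phi>]
    rapidly_decreasing_schwartz[OF schwartz_space_nderiv[OF \<phi>, of 1]]
  have eq: "(\<lambda>t. indicator {0<..} t *\<^sub>R nderiv 1 \<phi> t) = (\<lambda>t. truncated_power t 0 * nderiv 1 \<phi> t)"
    by (auto simp: truncated_power_def indicator_def fun_eq_iff)
  have "(LBINT t=0..\<infinity>. nderiv 1 \<phi> t) = 0 - \<phi> 0"
  proof (rule interval_integral_FTC_integrable[where F = \<phi>])
    show "(\<phi> has_vector_derivative nderiv 1 \<phi> t) (at t)" for t
      by (rule smooth_has_vector_derivative[OF smooth])
    show "isCont (nderiv 1 \<phi>) t" for t
      using continuous_on_nderiv[OF smooth, of UNIV 1]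
      by (auto simp: continuous_on_eq_continuous_at)
    show "set_integrable lborel (einterval 0 \<infinity>) (nderiv 1 \<phi>)"
      using integrable_truncated_power_mult[OF _ rd(2), of 1]
      by (simp add: set_integrable_def eq zero_ereal_def del: One_nat_def)
    have "(\<phi> \<longlongrightarrow> \<phi> 0) (at_right 0)"
      using has_vector_derivative_continuous[OF smooth_has_vector_derivative[OF smooth, of 0]]
      by (auto simp: continuous_at intro: tendsto_within_subset)
    then show "((\<phi> \<circ> real_of_ereal) \<longlongrightarrow> \<phi> 0) (at_right 0)"
      by (simp add: zero_ereal_def ereal_tendsto_simps)
    have "eventually (\<lambda>t. of_real t powr 0 * \<phi> t = \<phi> t) at_top"
      using eventually_gt_at_top[of 0] by eventually_elim simp
    then have "(\<phi> \<longlongrightarrow> 0) at_top"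
      by (rule Lim_transform_eventually[OF rapidly_decreasing_tendsto_0[OF rd(1), of 0]])
    then show "((\<phi> \<circ> real_of_ereal) \<longlongrightarrow> 0) (at_left \<infinity>)"
      by (simp add: ereal_tendsto_simps)
  qed simp
  then show ?thesis
    by (simp add: interval_lebesgue_integral_0_infty set_lebesgue_integral_def eq del: One_nat_def)
qed

section \<open>The kernels and their analytic continuation\<close>

text \<open>The Riemann-Liouville kernels before continuation. The body repeats the term inside
  \<open>K\<close> literally, so that the characterisation there can be stated through
  \<open>riesz\<close>.\<close>

definition riesz :: "complex \<Rightarrow> functional" where
  "riesz v = regular_dist (\<lambda>t. truncated_power t (v - 1) / Gamma v)"

text \<open>\<open>rGamma\<close> is entire, which removes the division from holomorphy arguments,
  and Borel measurability of \<phi> replaces the completed measure by \<open>lborel\<close>.\<close>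

lemma riesz_eq:
  assumes [measurable]: "\<phi> \<in> borel_measurable borel"
  shows "riesz v \<phi> = rGamma v * (LINT t|lborel. truncated_power t (v - 1) * \<phi> t)"
proof -
  have "riesz v \<phi> = (LINT t|lborel. truncated_power t (v - 1) / Gamma v * \<phi> t)"
    unfolding riesz_def regular_dist_def by (intro integral_completion) measurable
  also have "\<dots> = (LINT t|lborel. rGamma v * (truncated_power t (v - 1) * \<phi> t))"
    by (intro Bochner_Integration.integral_cong) (auto simp: rGamma_inverse_Gamma field_simps)
  finally show ?thesis by simp
qed

lemma borel_measurable_schwartz: "\<phi> \<in> schwartz_space X \<Longrightarrow> \<phi> \<in> borel_measurable borel"
  by (intro borel_measurable_smooth schwartz_spaceD_smooth)

text \<open>The factor v from integration by parts is absorbed by v / Gamma (v + 1) = 1 / Gamma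
  v.\<close>

lemma riesz_add_1:
  assumes "\<phi> \<in> schwartz_space {0..}" "Re v > 0"
  shows "riesz (v + 1) (nderiv 1 \<phi>) = - riesz v \<phi>"
  using arg_cong[OF truncated_power_integral_by_parts[OF assms], of "\<lambda>x. rGamma (v + 1) * x"]
  by (simp add: riesz_eq borel_measurable_schwartz[OF assms(1)]
      borel_measurable_schwartz[OF schwartz_space_nderiv[OF assms(1)]] mult_ac
      del: One_nat_def flip: rGamma_plus1[of v])

lemma riesz_1: "\<phi> \<in> schwartz_space {0..} \<Longrightarrow> riesz 1 (nderiv 1 \<phi>) = - \<phi> 0"
  by (simp add: riesz_eq borel_measurable_schwartz[OF schwartz_space_nderiv]
      integral_nderiv_half_line del: One_nat_def)

lemma riesz_add_of_nat:
  assumes "\<phi> \<in> schwartz_space {0..}" "Re v > 0"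
  shows "riesz (v + of_nat n) (nderiv n \<phi>) = (-1) ^ n * riesz v \<phi>"
proof (induction n)
  case (Suc n)
  have "riesz (v + of_nat n + 1) (nderiv 1 (nderiv n \<phi>)) = - riesz (v + of_nat n) (nderiv n \<phi>)"
    using assms by (intro riesz_add_1 schwartz_space_nderiv) auto
  then show ?case
    using Suc by (simp add: nderiv_nderiv add_ac)
qed simp

lemma holomorphic_riesz:
  assumes \<phi>: "\<phi> \<in> schwartz_space {0..}"
  shows "(\<lambda>v. riesz v \<phi>) holomorphic_on {v. Re v > 0}"
proof -
  note [measurable] = borel_measurable_schwartz[OF \<phi>]
  have "(\<lambda>v. LINT t|lborel. truncated_power t (v - 1) * \<phi> t) holomorphic_on {v. Re v > 0}"
  proof (rule holomorphic_on_integral)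
    show "open {v. Re v > 0}"
      by (rule open_halfspace_Re_gt)
    show "(\<lambda>v. truncated_power t (v - 1) * \<phi> t) holomorphic_on {v. Re v > 0}" for t
      unfolding truncated_power_eq_exp by (cases "t > 0") (auto intro!: holomorphic_intros)
    fix v\<^sub>0 :: complex assume "v\<^sub>0 \<in> {v. Re v > 0}"
    then have v0: "Re v\<^sub>0 > 0" by simp
    \<comment> \<open>Half the distance to the imaginary axis, so the strip of width 2 r around
      \<open>v\<^sub>0\<close> stays in the right half-plane.\<close>
    define r where "r = Re v\<^sub>0 / 2"
    define N where "N = nat \<lceil>Re v\<^sub>0 + r + 1\<rceil>"
    obtain C where C: "\<And>t. t \<ge> 0 \<Longrightarrow> (1 + t) ^ N * cmod (\<phi> t) \<le> C"
      using rapidly_decreasingE[OF rapidly_decreasing_schwartz[OF \<phi>]] by metis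
    show "\<exists>r>0. \<exists>g. integrable lborel g \<and>
        (\<forall>v\<in>ball v\<^sub>0 r. \<forall>t\<in>space lborel. cmod (truncated_power t (v - 1) * \<phi> t) \<le> g t)"
    proof (intro exI[of _ r] exI[of _ "\<lambda>t. C * powr_dominator (Re v\<^sub>0 - r) (Re v\<^sub>0 + r) N t"] conjI ballI)
      show "r > 0" using v0 by (simp add: r_def)
      then show "integrable lborel (\<lambda>t. C * powr_dominator (Re v\<^sub>0 - r) (Re v\<^sub>0 + r) N t)"
        using v0 by (intro integrable_mult_right integrable_powr_dominator)
          (auto simp: r_def N_def intro: real_nat_ceiling_ge)
      fix v t assume "v \<in> ball v\<^sub>0 r"
      then have "\<bar>Re v\<^sub>0 - Re v\<bar> < r"
        using abs_Re_le_cmod[of "v\<^sub>0 - v"] by (simp add: dist_norm)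
      then show "cmod (truncated_power t (v - 1) * \<phi> t)
          \<le> C * powr_dominator (Re v\<^sub>0 - r) (Re v\<^sub>0 + r) N t"
        by (intro truncated_power_mult_le_dominator C) auto
    qed
  qed measurable
  then show ?thesis
    unfolding riesz_eq[OF borel_measurable_schwartz[OF \<phi>]] by (intro holomorphic_intros)
qed

text \<open>The candidates for the continuation agree wherever two of them are defined: the one of
  higher order arises from the other by k - n integrations by parts. This allows them to be
  glued.\<close>

lemma riesz_continuation_unique:
  assumes \<phi>: "\<phi> \<in> schwartz_space {0..}" and "Re w > - real n" "Re w > - real k"
  shows "(-1) ^ n * riesz (w + of_nat n) (nderiv n \<phi>) = (-1) ^ k * riesz (w + of_nat k) (nderiv k \<phi>)"
  using assms(2,3)
proof (induction n k rule: linorder_wlog)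
  case (le n k)
  have "riesz (w + of_nat n + of_nat (k - n)) (nderiv (k - n) (nderiv n \<phi>))
      = (-1) ^ (k - n) * riesz (w + of_nat n) (nderiv n \<phi>)"
    using le by (intro riesz_add_of_nat schwartz_space_nderiv \<phi>) auto
  \<comment> \<open>Both sides agree because n and k + (k - n) have the same parity.\<close>
  moreover have "(-1::complex) ^ n = (-1) ^ k * (-1) ^ (k - n)"
    using le(1) by (simp add: minus_one_power_iff)
  ultimately show ?case
    using le(1) by (simp add: nderiv_nderiv of_nat_diff)
qed simp

text \<open>The description by \<open>THE\<close> gives a value only after an entire function has
  been exhibited. It is glued from the formulas on the half-planes Re w > -n, whose union is the
  plane; the identity theorem on the right half-plane gives uniqueness.\<close>

lemma K_eq_riesz:
  assumes \<phi>: "\<phi> \<in> schwartz_space {0..}" and w: "Re w > - real n"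
  shows "K w \<phi> = (-1) ^ n * riesz (w + of_nat n) (nderiv n \<phi>)"
proof -
  \<comment> \<open>Any n with Re w > -n would do; the \<open>+ 1\<close> makes the inequality
    strict.\<close>
  define F where "F = (\<lambda>w. let n = nat \<lceil>- Re w\<rceil> + 1 in (-1) ^ n * riesz (w + of_nat n) (nderiv n \<phi>))"
  have F_eq: "F w = (-1) ^ n * riesz (w + of_nat n) (nderiv n \<phi>)" if "Re w > - real n" for w n
    unfolding F_def Let_def using that
    by (intro riesz_continuation_unique[OF \<phi>]) (auto, linarith)
  have "F holomorphic_on (\<Union>n. {w. Re w > - real n})"
  proof (rule holomorphic_on_UN_open)
    fix n
    have "((\<lambda>v. riesz v (nderiv n \<phi>)) \<circ> (\<lambda>w. w + of_nat n)) holomorphic_on {w. Re w > - real n}"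
      by (rule holomorphic_on_compose_gen[OF _ holomorphic_riesz[OF schwartz_space_nderiv[OF \<phi>]]])
        (auto intro!: holomorphic_intros)
    then have "(\<lambda>w. (-1) ^ n * riesz (w + of_nat n) (nderiv n \<phi>)) holomorphic_on {w. Re w > - real n}"
      by (intro holomorphic_intros) (simp add: o_def)
    then show "F holomorphic_on {w. Re w > - real n}"
      by (rule holomorphic_transform) (simp add: F_eq)
    show "open {w. Re w > - real n}"
      by (rule open_halfspace_Re_gt)
  qed
  moreover have "(\<Union>n. {w. Re w > - real n}) = UNIV"
  proof -
    have "\<exists>n. Re w > - real n" for w
      using reals_Archimedean2[of "- Re w"] by (auto simp: minus_less_iff)
    then show ?thesis by auto
  qed
  ultimately have F: "F holomorphic_on UNIV"
    by simp
  have F_pos: "F v = riesz v \<phi>" if "Re v > 0" for v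
    using F_eq[of 0 v] that by simp
  have "(THE F. F holomorphic_on UNIV \<and>
      (\<forall>v. Re v > 0 \<longrightarrow> F v = regular_dist (\<lambda>t. truncated_power t (v - 1) / Gamma v) \<phi>)) = F"
  proof (rule the_equality)
    show "F holomorphic_on UNIV \<and>
        (\<forall>v. Re v > 0 \<longrightarrow> F v = regular_dist (\<lambda>t. truncated_power t (v - 1) / Gamma v) \<phi>)"
      using F F_pos by (simp add: riesz_def)
    fix G assume G: "G holomorphic_on UNIV \<and>
        (\<forall>v. Re v > 0 \<longrightarrow> G v = regular_dist (\<lambda>t. truncated_power t (v - 1) / Gamma v) \<phi>)"
    show "G = F"
    proof
      fix w
      show "G w = F w"
      proof (rule analytic_continuation_open[of "{v. Re v > 0}" UNIV G F w])
        have "(1::complex) \<in> {v. Re v > 0}" by simp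
        then show "{v. Re v > 0} \<noteq> {}" by blast
        show "G v = F v" if "v \<in> {v. Re v > 0}" for v
          using G F_pos that by (simp add: riesz_def)
      qed (use F G in \<open>auto intro: open_halfspace_Re_gt\<close>)
    qed
  qed
  then show ?thesis
    unfolding K_def using F_eq[OF w] by simp
qed

lemma K_eq_riesz_nderiv_1:
  assumes "\<phi> \<in> schwartz_space {0..}" "Re w \<ge> 0"
  shows "K w \<phi> = - riesz (w + 1) (nderiv 1 \<phi>)"
  using K_eq_riesz[OF assms(1), of 1 w] assms(2) by simp

section \<open>The semigroup law\<close>

text \<open>For s, y \<ge> 0 both 1 + s and 1 + y are at most 1 + s + y. Of the N + M powers of
  decay of f, N make the integral in y converge and M remain for s. The norm is inside the integral
  so that the bound also serves Fubini's theorem and sums over translates.\<close>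

lemma riesz_inner_decay:
  assumes f: "rapidly_decreasing f" and b: "Re b > 0"
  shows "\<exists>C. \<forall>s\<ge>0. (1 + s) ^ M * (LINT y|lborel. cmod (truncated_power y (b - 1) * f (s + y))) \<le> C"
proof -
  note [measurable] = rapidly_decreasingD_measurable[OF f]
  define N where "N = nat \<lceil>Re b + 1\<rceil>"
  obtain C where C: "\<And>t. t \<ge> 0 \<Longrightarrow> (1 + t) ^ (N + M) * cmod (f t) \<le> C"
    using rapidly_decreasingE[OF f] by metis
  have dom: "integrable lborel (powr_dominator (Re b) (Re b) N)"
    using b unfolding N_def by (intro integrable_powr_dominator real_nat_ceiling_ge) auto
  have "(1 + s) ^ M * (LINT y|lborel. cmod (truncated_power y (b - 1) * f (s + y)))
      \<le> C * integral\<^sup>L lborel (powr_dominator (Re b) (Re b) N)" if s: "s \<ge> 0" for s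
  proof -
    have "cmod (truncated_power y (b - 1) * f (s + y))
        \<le> C / (1 + s) ^ M * powr_dominator (Re b) (Re b) N y" for y
    proof (rule truncated_power_mult_le_dominator)
      assume y: "y > 0"
      have "(1 + y) ^ N * (1 + s) ^ M * cmod (f (s + y))
          \<le> (1 + (s + y)) ^ N * (1 + (s + y)) ^ M * cmod (f (s + y))"
        using s y by (intro mult_right_mono mult_mono power_mono) auto
      also have "\<dots> \<le> C"
        using C[of "s + y"] s y by (simp add: power_add)
      finally show "(1 + y) ^ N * cmod (f (s + y)) \<le> C / (1 + s) ^ M"
        using s by (simp add: pos_le_divide_eq mult_ac)
    qed auto
    then have "(LINT y|lborel. cmod (truncated_power y (b - 1) * f (s + y)))
        \<le> (LINT y|lborel. C / (1 + s) ^ M * powr_dominator (Re b) (Re b) N y)"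
      using b dom s
      by (intro integral_mono integrable_norm
          integrable_truncated_power_mult[OF b rapidly_decreasing_translate[OF f]]) auto
    then show ?thesis
      using s by (simp add: pos_le_divide_eq mult_ac)
  qed
  then show ?thesis by blast
qed

lemma rapidly_decreasing_inner_norm:
  assumes f: "rapidly_decreasing f" and b: "Re b > 0"
  shows "rapidly_decreasing
           (\<lambda>s. of_real (LINT y|lborel. cmod (truncated_power y (b - 1) * f (s + y))))"
proof -
  note [measurable] = rapidly_decreasingD_measurable[OF f]
  show ?thesis
    using riesz_inner_decay[OF assms] by (simp add: rapidly_decreasing_def)
qed

lemma rapidly_decreasing_inner:
  assumes f: "rapidly_decreasing f" and b: "Re b > 0"
  shows "rapidly_decreasing (\<lambda>s. LINT y|lborel. truncated_power y (b - 1) * f (s + y))"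
  unfolding rapidly_decreasing_def
proof (intro conjI allI)
  note [measurable] = rapidly_decreasingD_measurable[OF f]
  show "(\<lambda>s. LINT y|lborel. truncated_power y (b - 1) * f (s + y)) \<in> borel_measurable borel"
    by measurable
  fix M
  obtain C where C: "\<And>s. s \<ge> 0 \<Longrightarrow>
      (1 + s) ^ M * (LINT y|lborel. cmod (truncated_power y (b - 1) * f (s + y))) \<le> C"
    using riesz_inner_decay[OF assms] by metis
  have "(1 + s) ^ M * cmod (LINT y|lborel. truncated_power y (b - 1) * f (s + y)) \<le> C" if "s \<ge> 0" for s
  proof -
    have "(1 + s) ^ M * cmod (LINT y|lborel. truncated_power y (b - 1) * f (s + y))
        \<le> (1 + s) ^ M * (LINT y|lborel. cmod (truncated_power y (b - 1) * f (s + y)))"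
      using that by (intro mult_left_mono integral_norm_bound) auto
    also have "\<dots> \<le> C" by (rule C[OF that])
    finally show ?thesis .
  qed
  then show "\<exists>C. \<forall>s\<ge>0. (1 + s) ^ M * cmod (LINT y|lborel. truncated_power y (b - 1) * f (s + y)) \<le> C"
    by blast
qed

text \<open>Homogeneity: substituting s = u r extracts the power of u, one factor u being the
  Jacobian, and leaves a constant that is evaluated later. If the integral diverges, both sides take
  the default value 0 of the Bochner integral.\<close>

lemma truncated_power_convolution:
  "(LINT s|lborel. truncated_power s (a - 1) * truncated_power (u - s) (b - 1))
     = (LINT r|lborel. truncated_power r (a - 1) * truncated_power (1 - r) (b - 1))
         * truncated_power u (a + b - 1)"
proof (cases "u > 0")
  case True
  have "(LINT s|lborel. truncated_power s (a - 1) * truncated_power (u - s) (b - 1))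
      = u *\<^sub>R (LINT r|lborel. truncated_power (u * r) (a - 1) * truncated_power (u * (1 - r)) (b - 1))"
    using lborel_integral_real_affine[of u
        "\<lambda>s. truncated_power s (a - 1) * truncated_power (u - s) (b - 1)" 0] True
    by (simp add: algebra_simps)
  also have "\<dots> = u *\<^sub>R (LINT r|lborel. truncated_power u (a - 1) * truncated_power u (b - 1)
      * (truncated_power r (a - 1) * truncated_power (1 - r) (b - 1)))"
    using True by (intro arg_cong[where f = "\<lambda>x. u *\<^sub>R x"] Bochner_Integration.integral_cong)
      (auto simp: truncated_power_mult)
  also have "\<dots> = of_real u * (truncated_power u (a - 1) * truncated_power u (b - 1))
      * (LINT r|lborel. truncated_power r (a - 1) * truncated_power (1 - r) (b - 1))"
    unfolding integral_mult_right_zero scaleR_conv_of_real by (simp only: mult.assoc)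
  also have "of_real u * (truncated_power u (a - 1) * truncated_power u (b - 1))
      = truncated_power u (a + b - 1)"
  proof -
    have "of_real u = exp (of_real (ln u) :: complex)"
      using True by (simp add: exp_of_real)
    then show ?thesis
      using True by (simp add: truncated_power_eq_exp algebra_simps flip: exp_add)
  qed
  finally show ?thesis
    by (simp only: mult.commute)
next
  case False
  then have "(\<lambda>s. truncated_power s (a - 1) * truncated_power (u - s) (b - 1)) = (\<lambda>_. 0)"
    by (auto simp: truncated_power_def)
  then show ?thesis
    using False by (simp add: truncated_power_def)
qed

text \<open>With u = s + y and the order of integration exchanged, the inner integral over s is the
  convolution of two truncated powers. Keeping the constant as an integral lets a particular f
  determine it afterwards.\<close>

lemma truncated_power_double_integral:
  assumes f: "rapidly_decreasing f" and a: "Re a > 0" and b: "Re b > 0"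
  shows "(LINT s|lborel. truncated_power s (a - 1) * (LINT y|lborel. truncated_power y (b - 1) * f (s + y)))
     = (LINT r|lborel. truncated_power r (a - 1) * truncated_power (1 - r) (b - 1))
         * (LINT u|lborel. truncated_power u (a + b - 1) * f u)"
proof -
  note [measurable] = rapidly_decreasingD_measurable[OF f]
  define F where "F = (\<lambda>s u. truncated_power s (a - 1) * (truncated_power (u - s) (b - 1) * f u))"
  have shift: "(LINT y|lborel. truncated_power y (b - 1) * f (s + y))
      = (LINT u|lborel. truncated_power (u - s) (b - 1) * f u)" for s
    by (subst lborel_integral_real_affine[of 1 _ "-s"]) simp_all
  have shift_norm: "(LINT y|lborel. cmod (truncated_power y (b - 1) * f (s + y)))
      = (LINT u|lborel. cmod (truncated_power (u - s) (b - 1) * f u))" for s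
    by (subst lborel_integral_real_affine[of 1 _ "-s"]) simp_all
  have F_integrable: "integrable lborel (F s)" for s
  proof (cases "s > 0")
    case True
    have "integrable lborel (\<lambda>y. truncated_power y (b - 1) * f (s + y))"
      using True by (intro integrable_truncated_power_mult[OF b rapidly_decreasing_translate[OF f]]) simp
    from lborel_integrable_real_affine[OF this, of 1 "-s"]
    have "integrable lborel (\<lambda>u. truncated_power (u - s) (b - 1) * f u)"
      by simp
    then show ?thesis
      unfolding F_def by simp
  next
    case False
    then have "F s = (\<lambda>_. 0)"
      by (simp add: F_def truncated_power_def[of s])
    then show ?thesis by simp
  qed
  have "integrable (lborel \<Otimes>\<^sub>M lborel) (\<lambda>(s, u). F s u)"
  proof (rule lborel_pair.Fubini_integrable)
    show "(\<lambda>(s, u). F s u) \<in> borel_measurable (lborel \<Otimes>\<^sub>M lborel)"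
      unfolding F_def by measurable
    have "(LINT u|lborel. cmod (F s u))
        = cmod (truncated_power s (a - 1)
            * of_real (LINT y|lborel. cmod (truncated_power y (b - 1) * f (s + y))))" for s
      using shift_norm[of s] by (simp add: F_def norm_mult)
    then show "integrable lborel (\<lambda>s. LINT u|lborel. norm (case (s, u) of (s, u) \<Rightarrow> F s u))"
      using integrable_norm[OF integrable_truncated_power_mult[OF a rapidly_decreasing_inner_norm[OF f b]]]
      by simp
  qed (simp add: F_integrable)
  then have Fubini: "(LINT u|lborel. LINT s|lborel. F s u) = (LINT s|lborel. LINT u|lborel. F s u)"
    by (rule lborel_pair.Fubini_integral)
  have int_s: "(LINT s|lborel. F s u)
      = (LINT r|lborel. truncated_power r (a - 1) * truncated_power (1 - r) (b - 1))
         * (truncated_power u (a + b - 1) * f u)" for u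
  proof -
    have "(LINT s|lborel. F s u)
        = (LINT s|lborel. truncated_power s (a - 1) * truncated_power (u - s) (b - 1)) * f u"
      unfolding F_def mult.assoc[symmetric] by (rule integral_mult_left_zero)
    then show ?thesis
      by (subst (asm) truncated_power_convolution) (simp only: mult.assoc)
  qed
  have int_u: "(LINT u|lborel. F s u)
      = truncated_power s (a - 1) * (LINT y|lborel. truncated_power y (b - 1) * f (s + y))" for s
    unfolding F_def shift by (rule integral_mult_right_zero)
  show ?thesis
    using Fubini unfolding int_s int_u integral_mult_right_zero by (rule sym)
qed

lemma rapidly_decreasing_exp: "rapidly_decreasing (\<lambda>t. of_real (exp (- t)))"
  unfolding rapidly_decreasing_def
proof (intro conjI allI)
  fix N :: nat
  have "(1 + t) ^ N * cmod (of_real (exp (- t))) \<le> max 1 (real N) ^ N" if t: "t \<ge> 0" for t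
  proof (cases "N = 0")
    case False
    \<comment> \<open>Prepares the comparison with (1 + t / N)^N \<le> exp t, which gives the
      explicit constant N^N.\<close>
    have "1 + t \<le> real N * (1 + t / real N)"
      using False by (simp add: distrib_left)
    then have "(1 + t) ^ N \<le> (real N * (1 + t / real N)) ^ N"
      using t by (intro power_mono) auto
    also have "\<dots> = real N ^ N * (1 + t / real N) ^ N"
      by (rule power_mult_distrib)
    also have "\<dots> \<le> real N ^ N * exp t"
      using False t by (intro mult_left_mono exp_ge_one_plus_x_over_n_power_n) auto
    finally have "(1 + t) ^ N * exp (- t) \<le> real N ^ N * exp t * exp (- t)"
      by (rule mult_right_mono) simp
    also have "\<dots> = real N ^ N"
      by (simp add: exp_minus)
    also have "\<dots> \<le> max 1 (real N) ^ N"
      by (intro power_mono) auto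
    finally show ?thesis by simp
  qed (use t in simp)
  then show "\<exists>C. \<forall>t\<ge>0. (1 + t) ^ N * cmod (of_real (exp (- t))) \<le> C"
    by blast
qed measurable

lemma truncated_power_Gamma_integral:
  assumes "Re v > 0"
  shows "(LINT t|lborel. truncated_power t (v - 1) * of_real (exp (- t))) = Gamma v"
proof -
  let ?f = "\<lambda>t. truncated_power t (v - 1) * of_real (exp (- t))"
  have "(?f has_integral (LINT t|lborel. ?f t)) UNIV"
    by (intro has_integral_integral_lborel integrable_truncated_power_mult assms rapidly_decreasing_exp)
  moreover have "(?f has_integral Gamma v) UNIV"
  proof -
    have "?f = (\<lambda>t. if t \<in> {0<..} then of_real t powr (v - 1) / of_real (exp t) else 0)"
      by (auto simp: truncated_power_def exp_minus field_simps)
    then show ?thesis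
      using Gamma_integral_complex'[OF assms] by (simp only: has_integral_restrict_UNIV)
  qed
  ultimately show ?thesis
    by (rule has_integral_unique)
qed

text \<open>The double-integral identity tested on f (t) = exp (- t): since exp (- (s + y))
  factorises, the left side splits into two Gamma integrals and the right side contains a
  third.\<close>

lemma truncated_power_Beta:
  assumes a: "Re a > 0" and b: "Re b > 0"
  shows "Gamma a * Gamma b
    = (LINT r|lborel. truncated_power r (a - 1) * truncated_power (1 - r) (b - 1)) * Gamma (a + b)"
proof -
  have "(LINT y|lborel. truncated_power y (b - 1) * of_real (exp (- (s + y))))
      = Gamma b * of_real (exp (- s))" for s
  proof -
    have "(LINT y|lborel. truncated_power y (b - 1) * of_real (exp (- (s + y))))
        = (LINT y|lborel. truncated_power y (b - 1) * of_real (exp (- y)) * of_real (exp (- s)))"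
      by (intro Bochner_Integration.integral_cong) (auto simp: exp_add exp_diff exp_minus field_simps)
    then show ?thesis
      using truncated_power_Gamma_integral[OF b] by simp
  qed
  then have "(LINT s|lborel. truncated_power s (a - 1) * (Gamma b * of_real (exp (- s))))
      = (LINT r|lborel. truncated_power r (a - 1) * truncated_power (1 - r) (b - 1)) * Gamma (a + b)"
    using truncated_power_double_integral[OF rapidly_decreasing_exp a b]
      truncated_power_Gamma_integral[of "a + b"] a b by simp
  moreover have "(LINT s|lborel. truncated_power s (a - 1) * (Gamma b * of_real (exp (- s))))
      = (LINT s|lborel. Gamma b * (truncated_power s (a - 1) * of_real (exp (- s))))"
    by (simp add: mult_ac)
  ultimately show ?thesis
    using truncated_power_Gamma_integral[OF a] by (simp add: mult.commute)
qed

text \<open>The constant in the double integral is Gamma a Gamma b / Gamma (a + b), exactly what the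
  normalising factors absorb.\<close>

lemma riesz_semigroup:
  assumes f: "rapidly_decreasing f" and a: "Re a > 0" and b: "Re b > 0"
  shows "riesz a (\<lambda>s. riesz b (\<lambda>y. f (s + y))) = riesz (a + b) f"
proof -
  note [measurable] = rapidly_decreasingD_measurable[OF f]
  define c where "c = (LINT r|lborel. truncated_power r (a - 1) * truncated_power (1 - r) (b - 1))"
  have "Gamma v \<noteq> 0" if "Re v > 0" for v
    using that by (auto simp: Gamma_eq_zero_iff elim!: nonpos_Ints_cases)
  then have nz: "Gamma a \<noteq> 0" "Gamma b \<noteq> 0" "Gamma (a + b) \<noteq> 0"
    using a b by auto
  have "riesz a (\<lambda>s. riesz b (\<lambda>y. f (s + y)))
      = rGamma a * rGamma b * (LINT s|lborel. truncated_power s (a - 1)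
          * (LINT y|lborel. truncated_power y (b - 1) * f (s + y)))"
    by (simp add: riesz_eq mult.left_commute[of _ "rGamma b"])
  also have "\<dots> = rGamma a * rGamma b * c * (LINT u|lborel. truncated_power u (a + b - 1) * f u)"
    unfolding truncated_power_double_integral[OF assms] c_def by simp
  also have "rGamma a * rGamma b * c = rGamma (a + b)"
  proof -
    have Beta: "Gamma a * Gamma b = c * Gamma (a + b)"
      unfolding c_def by (rule truncated_power_Beta[OF a b])
    have "inverse (Gamma a) * inverse (Gamma b) * c = inverse (Gamma a * Gamma b) * c"
      by simp
    also have "\<dots> = inverse (Gamma (a + b))"
      using nz Beta by (auto simp: field_simps)
    finally show ?thesis
      by (simp add: rGamma_inverse_Gamma)
  qed
  finally show ?thesis
    by (simp add: riesz_eq)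
qed

section \<open>Differentiating a kernel pairing under translation\<close>

lemma has_vector_derivative_iff_tendsto:
  "(f has_vector_derivative D) (at x) \<longleftrightarrow> ((\<lambda>h. (f (x + h) - f x) /\<^sub>R h) \<longlongrightarrow> D) (at 0)"
proof -
  have "norm (f (x + h) - f x - h *\<^sub>R D) / norm h = norm ((f (x + h) - f x) /\<^sub>R h - D)" if "h \<noteq> 0" for h
  proof -
    have "(f (x + h) - f x) /\<^sub>R h - D = (f (x + h) - f x - h *\<^sub>R D) /\<^sub>R h"
      using that by (simp add: scaleR_diff_right)
    then show ?thesis
      by (simp add: divide_inverse_commute)
  qed
  then have "((\<lambda>h. norm (f (x + h) - f x - h *\<^sub>R D) / norm h) \<longlongrightarrow> 0) (at 0)
      \<longleftrightarrow> ((\<lambda>h. norm ((f (x + h) - f x) /\<^sub>R h - D)) \<longlongrightarrow> 0) (at 0)"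
    by (intro Lim_cong_within) auto
  then show ?thesis
    by (simp add: has_vector_derivative_def has_derivative_at bounded_linear_scaleR_left
        tendsto_norm_zero_iff LIM_zero_iff)
qed

lemma vector_differentiable_bound:
  fixes f :: "real \<Rightarrow> 'b::real_normed_vector"
  assumes "convex S" "\<And>x. x \<in> S \<Longrightarrow> (f has_vector_derivative f' x) (at x within S)"
    and "\<And>x. x \<in> S \<Longrightarrow> norm (f' x) \<le> B" and "x \<in> S" "y \<in> S"
  shows "norm (f x - f y) \<le> B * norm (x - y)"
proof (rule differentiable_bound[where f' = "\<lambda>x h. h *\<^sub>R f' x" and S = S])
  fix x assume x: "x \<in> S"
  then show "(f has_derivative (\<lambda>h. h *\<^sub>R f' x)) (at x within S)"
    using assms(2) by (simp add: has_vector_derivative_def)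
  show "onorm (\<lambda>h. h *\<^sub>R f' x) \<le> B"
    using assms(3)[OF x] by (intro onorm_le) (simp add: mult.commute[of B] mult_left_mono)
qed (use assms in auto)

text \<open>By the mean value inequality the difference quotient in x is controlled by \<phi>' near
  x + y, whose decay dominates the integrand uniformly in h. As x may be negative, \<phi> has to
  decay on the whole line.\<close>

lemma riesz_translate_has_vector_derivative:
  assumes \<phi>: "\<phi> \<in> schwartz_space UNIV" and v: "Re v > 0"
  shows "((\<lambda>x. riesz v (\<lambda>y. \<phi> (x + y))) has_vector_derivative riesz v (\<lambda>y. nderiv 1 \<phi> (x + y))) (at x)"
proof -
  note smooth = schwartz_spaceD_smooth[OF \<phi>]
  note [measurable] = borel_measurable_schwartz[OF \<phi>]
    borel_measurable_schwartz[OF schwartz_space_nderiv[OF \<phi>], of 1]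
  have half: "schwartz_space UNIV \<subseteq> schwartz_space {0..}"
    by (intro schwartz_space_antimono) auto
  have int: "integrable lborel (\<lambda>y. truncated_power y (v - 1) * \<phi> (x + y))" for x
    by (intro integrable_truncated_power_mult v rapidly_decreasing_schwartz
        subsetD[OF half schwartz_space_translate[OF \<phi>]])
  define N where "N = nat \<lceil>Re v + 1\<rceil>"
  obtain C where C: "\<And>u. (1 + \<bar>u\<bar>) ^ N * cmod (nderiv 1 \<phi> u) \<le> C"
    using schwartz_space_decay[OF \<phi>] by (metis UNIV_I)
  \<comment> \<open>Peetre's inequality again, with 2 in place of 1 because u may lie up to distance
    1 from x + y.\<close>
  define C' where "C' = (2 + \<bar>x\<bar>) ^ N * C"
  have bound: "(1 + y) ^ N * cmod (nderiv 1 \<phi> u) \<le> C'" if y: "y > 0" and u: "\<bar>u - (x + y)\<bar> < 1" for y u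
  proof -
    have "1 + y \<le> 2 + \<bar>x\<bar> + \<bar>u\<bar>"
      using u by linarith
    also have "\<dots> \<le> 2 + \<bar>x\<bar> + 2 * \<bar>u\<bar> + \<bar>x\<bar> * \<bar>u\<bar>"
      by simp
    finally have "1 + y \<le> 2 + \<bar>x\<bar> + 2 * \<bar>u\<bar> + \<bar>x\<bar> * \<bar>u\<bar>" .
    then have "1 + y \<le> (2 + \<bar>x\<bar>) * (1 + \<bar>u\<bar>)"
      by (simp add: algebra_simps)
    then have "(1 + y) ^ N * cmod (nderiv 1 \<phi> u) \<le> ((2 + \<bar>x\<bar>) * (1 + \<bar>u\<bar>)) ^ N * cmod (nderiv 1 \<phi> u)"
      using y by (intro mult_right_mono power_mono) auto
    also have "\<dots> = (2 + \<bar>x\<bar>) ^ N * ((1 + \<bar>u\<bar>) ^ N * cmod (nderiv 1 \<phi> u))"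
      by (simp add: power_mult_distrib mult_ac)
    also have "\<dots> \<le> C'"
      unfolding C'_def by (intro mult_left_mono C) auto
    finally show ?thesis .
  qed
  have "((\<lambda>h. LINT y|lborel. truncated_power y (v - 1) * ((\<phi> (x + h + y) - \<phi> (x + y)) /\<^sub>R h))
      \<longlongrightarrow> (LINT y|lborel. truncated_power y (v - 1) * nderiv 1 \<phi> (x + y))) (at 0)"
  proof (rule tendsto_integral_at)
    show "integrable lborel (\<lambda>y. C' * powr_dominator (Re v) (Re v) N y)"
      using v unfolding N_def
      by (intro integrable_mult_right integrable_powr_dominator real_nat_ceiling_ge) auto
    show "((\<lambda>h. truncated_power y (v - 1) * ((\<phi> (x + h + y) - \<phi> (x + y)) /\<^sub>R h))
        \<longlongrightarrow> truncated_power y (v - 1) * nderiv 1 \<phi> (x + y)) (at 0)" for y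
    proof (intro tendsto_mult tendsto_const)
      show "((\<lambda>h. (\<phi> (x + h + y) - \<phi> (x + y)) /\<^sub>R h) \<longlongrightarrow> nderiv 1 \<phi> (x + y)) (at 0)"
        using smooth_has_vector_derivative[OF smooth, of "x + y"]
        unfolding has_vector_derivative_iff_tendsto by (simp only: ac_simps)
    qed
    have "eventually (\<lambda>h. h \<in> ball 0 1 - {0}) (at (0::real))"
      by (intro eventually_at_in_open) auto
    then show "eventually (\<lambda>h. (\<lambda>y. truncated_power y (v - 1) * ((\<phi> (x + h + y) - \<phi> (x + y)) /\<^sub>R h))
          \<in> borel_measurable lborel \<and> (\<forall>y\<in>space lborel.
        cmod (truncated_power y (v - 1) * ((\<phi> (x + h + y) - \<phi> (x + y)) /\<^sub>R h))
          \<le> C' * powr_dominator (Re v) (Re v) N y)) (at 0)"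
    proof eventually_elim
      case (elim h)
      have "cmod (truncated_power y (v - 1) * ((\<phi> (x + h + y) - \<phi> (x + y)) /\<^sub>R h))
          \<le> C' * powr_dominator (Re v) (Re v) N y" for y
      proof (rule truncated_power_mult_le_dominator)
        assume y: "y > 0"
        have "cmod (\<phi> (x + h + y) - \<phi> (x + y)) \<le> C' / (1 + y) ^ N * norm (x + h + y - (x + y))"
        proof (rule vector_differentiable_bound)
          show "convex (ball (x + y) 1)" by simp
          fix u assume "u \<in> ball (x + y) 1"
          then have "\<bar>u - (x + y)\<bar> < 1"
            by (simp add: dist_real_def abs_minus_commute)
          from bound[OF y this] show "cmod (nderiv 1 \<phi> u) \<le> C' / (1 + y) ^ N"
            using y by (simp add: pos_le_divide_eq mult.commute)
          show "(\<phi> has_vector_derivative nderiv 1 \<phi> u) (at u within ball (x + y) 1)"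
            by (rule has_vector_derivative_at_within[OF smooth_has_vector_derivative[OF smooth]])
        qed (use elim in \<open>auto simp: dist_real_def\<close>)
        then show "(1 + y) ^ N * cmod ((\<phi> (x + h + y) - \<phi> (x + y)) /\<^sub>R h) \<le> C'"
          unfolding norm_scaleR using y elim by (simp add: field_simps)
      qed auto
      then show ?case by auto
    qed
  qed
  moreover have "(LINT y|lborel. truncated_power y (v - 1) * ((\<phi> (x + h + y) - \<phi> (x + y)) /\<^sub>R h))
      = ((LINT y|lborel. truncated_power y (v - 1) * \<phi> (x + h + y))
          - (LINT y|lborel. truncated_power y (v - 1) * \<phi> (x + y))) /\<^sub>R h" for h
    using int[of "x + h"] int[of x] by (simp add: right_diff_distrib)
  ultimately have "((\<lambda>x. LINT y|lborel. truncated_power y (v - 1) * \<phi> (x + y)) has_vector_derivative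
      (LINT y|lborel. truncated_power y (v - 1) * nderiv 1 \<phi> (x + y))) (at x)"
    unfolding has_vector_derivative_iff_tendsto by (simp only:)
  from has_vector_derivative_mult_right[OF this, of "rGamma v"] show ?thesis
    by (simp add: riesz_eq del: One_nat_def)
qed

section \<open>The spline\<close>

text \<open>Only boundedness is extracted from the asymptotic formula: the limit of the normalised
  quotient is 0 for natural z, where the binomial coefficients eventually vanish.\<close>

lemma summable_norm_gchoose:
  assumes "Re z > 0"
  shows "summable (\<lambda>k. cmod (z gchoose k))"
proof -
  let ?q = "\<lambda>n. (z gchoose n) / ((-1) ^ n / exp ((z + 1) * of_real (ln (real n))))"
  have "Bseq ?q"
    by (rule convergent_imp_Bseq[OF convergentI[OF gbinomial_asymptotic]])
  then obtain M where M: "\<And>n. cmod (?q n) \<le> M"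
    by (rule BseqE) blast
  have le: "norm (cmod (z gchoose n)) \<le> M * real n powr (- (Re z + 1))" if n: "n \<ge> 1" for n
  proof -
    have "cmod (?q n) = cmod (z gchoose n) * exp ((Re z + 1) * ln (real n))"
      by (simp add: norm_divide norm_mult norm_power)
    also have "exp ((Re z + 1) * ln (real n)) = real n powr (Re z + 1)"
      using n by (simp add: powr_def)
    finally have "cmod (z gchoose n) * real n powr (Re z + 1) \<le> M"
      using M[of n] by simp
    then show ?thesis
      unfolding powr_minus_divide using n by (simp add: pos_le_divide_eq)
  qed
  have "summable (\<lambda>n. M * real n powr (- (Re z + 1)))"
    using assms by (intro summable_mult) (simp add: summable_real_powr_iff)
  then show ?thesis
    using le by (rule summable_comparison_test')
qed

lemma rapidly_decreasing_mult:
  assumes "rapidly_decreasing f"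
  shows "rapidly_decreasing (\<lambda>x. c * f x)"
  unfolding rapidly_decreasing_def
proof (intro conjI allI)
  show "(\<lambda>x. c * f x) \<in> borel_measurable borel"
    using rapidly_decreasingD_measurable[OF assms] by measurable
  fix N
  obtain C where C: "\<And>t. t \<ge> 0 \<Longrightarrow> (1 + t) ^ N * cmod (f t) \<le> C"
    using rapidly_decreasingE[OF assms] by metis
  have "(1 + t) ^ N * cmod (c * f t) \<le> cmod c * C" if "t \<ge> 0" for t
    using mult_left_mono[OF C[OF that], of "cmod c"] by (simp add: norm_mult mult_ac)
  then show "\<exists>C. \<forall>t\<ge>0. (1 + t) ^ N * cmod (c * f t) \<le> C"
    by blast
qed

definition spline_coeff :: "complex \<Rightarrow> nat \<Rightarrow> complex" where
  "spline_coeff z k = (-1) ^ k * (z gchoose k)"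

lemma summable_norm_spline_coeff: "Re z > 0 \<Longrightarrow> summable (\<lambda>k. cmod (spline_coeff z k))"
  using summable_norm_gchoose[of z] by (simp add: spline_coeff_def norm_mult norm_power)

section \<open>Growth and integrability of the spline\<close>

lemma B_spline_eq:
  "B_spline z x = rGamma z * (\<Sum>k. spline_coeff z k * truncated_power (x - real k) (z - 1))"
  by (simp add: B_spline_def spline_coeff_def rGamma_inverse_Gamma inverse_eq_divide)

text \<open>The bound apart from the coefficient is uniform in k, since x - k \<le> x and the
  exponent Re z - 1 is positive. The exponent is rounded up to a natural number to give polynomial
  growth, and the indicator records the support, so that seminorms over the half-line suffice
  later.\<close>

lemma B_spline_term_le:
  assumes "Re z > 1"
  shows "cmod (spline_coeff z k * truncated_power (x - real k) (z - 1))
           \<le> cmod (spline_coeff z k) * (indicator {0<..} x * (1 + \<bar>x\<bar>) ^ nat \<lceil>Re z\<rceil>)"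
proof -
  have "cmod (truncated_power (x - real k) (z - 1)) \<le> indicator {0<..} x * (1 + \<bar>x\<bar>) ^ nat \<lceil>Re z\<rceil>"
  proof (cases "x - real k > 0")
    case True
    have "(x - real k) powr (Re z - 1) \<le> (1 + \<bar>x\<bar>) powr (Re z - 1)"
      using True assms by (intro powr_mono2) auto
    also have "\<dots> \<le> (1 + \<bar>x\<bar>) powr real (nat \<lceil>Re z\<rceil>)"
      using real_nat_ceiling_ge[of "Re z"] by (intro powr_mono) linarith+
    also have "\<dots> = (1 + \<bar>x\<bar>) ^ nat \<lceil>Re z\<rceil>"
      by (intro powr_realpow) auto
    finally show ?thesis
      using True by (simp add: cmod_truncated_power)
  qed (simp add: cmod_truncated_power)
  then show ?thesis
    by (simp only: norm_mult mult_left_mono norm_ge_zero)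
qed

lemma summable_B_spline:
  assumes "Re z > 1"
  shows "summable (\<lambda>k. cmod (spline_coeff z k * truncated_power (x - real k) (z - 1)))"
  by (rule summable_comparison_test'[OF summable_mult2[OF summable_norm_spline_coeff], of z 0])
    (use assms B_spline_term_le[OF assms] in auto)

lemma B_spline_growth:
  assumes "Re z > 1"
  obtains C where "C \<ge> 0"
    "\<And>x. cmod (B_spline z x) \<le> C * (indicator {0<..} x * (1 + \<bar>x\<bar>) ^ nat \<lceil>Re z\<rceil>)"
proof
  let ?A = "\<Sum>k. cmod (spline_coeff z k)"
  have A: "summable (\<lambda>k. cmod (spline_coeff z k))"
    using assms by (intro summable_norm_spline_coeff) auto
  show "cmod (rGamma z) * ?A \<ge> 0"
    by (intro mult_nonneg_nonneg suminf_nonneg A) auto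
  fix x
  let ?g = "indicator {0<..} x * (1 + \<bar>x\<bar>) ^ nat \<lceil>Re z\<rceil> :: real"
  have "cmod (\<Sum>k. spline_coeff z k * truncated_power (x - real k) (z - 1))
      \<le> (\<Sum>k. cmod (spline_coeff z k * truncated_power (x - real k) (z - 1)))"
    by (intro summable_norm summable_B_spline assms)
  also have "\<dots> \<le> (\<Sum>k. cmod (spline_coeff z k) * ?g)"
    by (intro suminf_le B_spline_term_le summable_B_spline summable_mult2 A assms)
  also have "\<dots> = ?A * ?g"
    by (rule suminf_mult2[OF A, symmetric])
  finally show "cmod (B_spline z x) \<le> cmod (rGamma z) * ?A * ?g"
    unfolding B_spline_eq norm_mult mult.assoc by (rule mult_left_mono) simp
qed

lemma borel_measurable_B_spline [measurable]: "B_spline z \<in> borel_measurable borel"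
  unfolding B_spline_eq[abs_def] by measurable

lemma slowly_growing_B_spline:
  assumes "Re z > 1"
  shows "slowly_growing (B_spline z)"
  unfolding slowly_growing_def
proof (intro conjI allI)
  let ?N = "nat \<lceil>Re z\<rceil>"
  obtain C where C: "C \<ge> 0"
    "\<And>x. cmod (B_spline z x) \<le> C * (indicator {0<..} x * (1 + \<bar>x\<bar>) ^ ?N)"
    using B_spline_growth[OF assms] by metis
  have le: "cmod (B_spline z x) \<le> C * (1 + \<bar>x\<bar>) ^ ?N" for x
  proof -
    have "C * (indicator {0<..} x * (1 + \<bar>x\<bar>) ^ ?N) \<le> C * (1 + \<bar>x\<bar>) ^ ?N"
      using C(1) by (intro mult_left_mono) (auto simp: indicator_def)
    then show ?thesis
      using C(2)[of x] by linarith
  qed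
  then show "\<exists>C N. \<forall>t. cmod (B_spline z t) \<le> C * (1 + \<bar>t\<bar>) ^ N"
    by blast
  fix a b
  show "B_spline z absolutely_integrable_on {a..b}"
  proof (rule measurable_bounded_by_integrable_imp_absolutely_integrable)
    show "B_spline z \<in> borel_measurable (lebesgue_on {a..b})"
      by (intro measurable_restrict_space1 measurable_completion) measurable
    show "(\<lambda>t. C * (1 + \<bar>t\<bar>) ^ ?N) integrable_on {a..b}"
      by (intro integrable_continuous_interval continuous_intros)
  qed (use le in auto)
qed

lemma regular_dist_eq_lborel:
  assumes [measurable]: "f \<in> borel_measurable borel" "\<phi> \<in> borel_measurable borel"
  shows "regular_dist f \<phi> = (LINT t|lborel. f t * \<phi> t)"
  unfolding regular_dist_def by (intro integral_completion) measurable

lemma regular_dist_B_spline_half_line: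
  assumes z: "Re z > 1"
  shows "regular_dist (B_spline z) \<in> half_line_distributions"
proof -
  let ?N = "nat \<lceil>Re z\<rceil>"
  \<comment> \<open>On t > 0 this is 1 / (1 + t)^2, written in the shape of
    \<open>integrable_powr_decay\<close> for a = 1.\<close>
  let ?g = "\<lambda>t::real. indicator {0<..} t * (t powr (1 - 1) / (1 + t) ^ 2)"
  obtain C where C: "C \<ge> 0"
    "\<And>x. cmod (B_spline z x) \<le> C * (indicator {0<..} x * (1 + \<bar>x\<bar>) ^ ?N)"
    using B_spline_growth[OF z] by metis
  have g: "integrable lborel ?g"
    by (rule integrable_powr_decay) auto
  \<comment> \<open>Of the \<open>?N + 2\<close> powers of decay, \<open>?N\<close> absorb the
    growth of the spline and two make the integral converge.\<close>
  define S where "S = (\<lambda>\<phi>. 2 ^ (?N + 2) * (schwartz_seminorm {0..} 0 0 \<phi> + schwartz_seminorm {0..} (?N + 2) 0 \<phi>))"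
  have le: "cmod (B_spline z t * \<phi> t) \<le> C * S \<phi> * ?g t" if \<phi>: "\<phi> \<in> schwartz_space {0..}" for \<phi> t
  proof (cases "t > 0")
    case True
    have "(1 + t) ^ (?N + 2) * cmod (\<phi> t) \<le> S \<phi>"
      using schwartz_seminorm_decay[OF \<phi>, of t "?N + 2" 0] True by (simp add: S_def)
    then have "(1 + t) ^ ?N * cmod (\<phi> t) \<le> S \<phi> / (1 + t) ^ 2"
      using True by (simp add: pos_le_divide_eq power_add power2_eq_square mult_ac)
    then have "C * ((1 + t) ^ ?N * cmod (\<phi> t)) \<le> C * (S \<phi> / (1 + t) ^ 2)"
      by (rule mult_left_mono[OF _ C(1)])
    moreover have "cmod (B_spline z t) * cmod (\<phi> t) \<le> C * (1 + t) ^ ?N * cmod (\<phi> t)"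
      using C(2)[of t] True by (intro mult_right_mono) auto
    ultimately show ?thesis
      using True by (simp add: norm_mult mult.assoc)
  next
    case False
    then have "B_spline z t = 0"
      using C(2)[of t] by simp
    then show ?thesis
      using False by simp
  qed
  have int: "integrable lborel (\<lambda>t. B_spline z t * \<phi> t)" if \<phi>: "\<phi> \<in> schwartz_space {0..}" for \<phi>
  proof (rule Bochner_Integration.integrable_bound)
    note [measurable] = borel_measurable_schwartz[OF \<phi>]
    show "integrable lborel (\<lambda>t. C * S \<phi> * ?g t)"
      by (intro integrable_mult_right g)
    show "(\<lambda>t. B_spline z t * \<phi> t) \<in> borel_measurable lborel"
      by measurable
    show "AE t in lborel. norm (B_spline z t * \<phi> t) \<le> norm (C * S \<phi> * ?g t)"
    proof (rule AE_I2)
      fix t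
      show "norm (B_spline z t * \<phi> t) \<le> norm (C * S \<phi> * ?g t)"
        using le[OF \<phi>, of t] unfolding real_norm_def by linarith
    qed
  qed
  show ?thesis
    unfolding half_line_distributions_def
  proof (rule topological_dualI)
    show "linear_functional_on (schwartz_space {0..}) (regular_dist (B_spline z))"
      unfolding linear_functional_on_def
    proof (intro ballI allI)
      fix \<phi> \<psi> c d assume \<phi>: "\<phi> \<in> schwartz_space {0..}" and \<psi>: "\<psi> \<in> schwartz_space {0..}"
      note [measurable] = borel_measurable_schwartz[OF \<phi>] borel_measurable_schwartz[OF \<psi>]
      have "(LINT t|lborel. B_spline z t * (c * \<phi> t + d * \<psi> t))
          = (LINT t|lborel. c * (B_spline z t * \<phi> t) + d * (B_spline z t * \<psi> t))"
        by (simp add: algebra_simps)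
      also have "\<dots> = c * (LINT t|lborel. B_spline z t * \<phi> t) + d * (LINT t|lborel. B_spline z t * \<psi> t)"
        using int[OF \<phi>] int[OF \<psi>] by simp
      finally show "regular_dist (B_spline z) (\<lambda>x. c * \<phi> x + d * \<psi> x)
          = c * regular_dist (B_spline z) \<phi> + d * regular_dist (B_spline z) \<psi>"
        by (simp add: regular_dist_eq_lborel)
    qed
    show "cmod (regular_dist (B_spline z) \<phi>) \<le> C * 2 ^ (?N + 2) * integral\<^sup>L lborel ?g
        * (schwartz_seminorm {0..} 0 0 \<phi> + schwartz_seminorm {0..} (?N + 2) 0 \<phi>)"
      if \<phi>: "\<phi> \<in> schwartz_space {0..}" for \<phi>
    proof -
      note [measurable] = borel_measurable_schwartz[OF \<phi>]
      have "cmod (LINT t|lborel. B_spline z t * \<phi> t) \<le> (LINT t|lborel. cmod (B_spline z t * \<phi> t))"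
        by (rule integral_norm_bound)
      also have "\<dots> \<le> (LINT t|lborel. C * S \<phi> * ?g t)"
        by (intro integral_mono integrable_norm int[OF \<phi>] integrable_mult_right g le[OF \<phi>])
      also have "\<dots> = C * S \<phi> * integral\<^sup>L lborel ?g"
        by (rule integral_mult_right_zero)
      finally show ?thesis
        by (simp add: regular_dist_eq_lborel S_def mult_ac)
    qed
  qed auto
qed

text \<open>Summation and integration commute because the L1 norms are summable: after the shift by
  k each is the modulus of a coefficient times an integral bounded uniformly in k. The statement
  asks only for \<open>rapidly_decreasing\<close>, as it will be applied to a kernel
  pairing.\<close>

lemma regular_dist_B_spline_eq_suminf:
  assumes z: "Re z > 1" and g: "rapidly_decreasing g"
  shows "regular_dist (B_spline z) g = (\<Sum>k. spline_coeff z k * riesz z (\<lambda>s. g (real k + s)))"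
proof -
  note [measurable] = rapidly_decreasingD_measurable[OF g]
  define h where "h = (\<lambda>k t. spline_coeff z k * (truncated_power (t - real k) (z - 1) * g t))"
  have z0: "Re z > 0" using z by simp
  have shift: "(LINT t|lborel. truncated_power (t - x) (z - 1) * g t)
      = (LINT s|lborel. truncated_power s (z - 1) * g (x + s))" for x
    by (subst lborel_integral_real_affine[of 1 _ x]) simp_all
  have shift_norm: "(LINT t|lborel. cmod (truncated_power (t - x) (z - 1) * g t))
      = (LINT s|lborel. cmod (truncated_power s (z - 1) * g (x + s)))" for x
    by (subst lborel_integral_real_affine[of 1 _ x]) simp_all
  \<comment> \<open>M = 0: uniform boundedness over all right translates is what the sum over k
    requires.\<close>
  obtain C where C: "\<And>s. s \<ge> 0 \<Longrightarrow> (LINT y|lborel. cmod (truncated_power y (z - 1) * g (s + y))) \<le> C"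
    using riesz_inner_decay[OF g z0, of 0] by auto
  have int: "integrable lborel (h k)" for k
  proof -
    have "integrable lborel (\<lambda>s. truncated_power s (z - 1) * g (real k + s))"
      by (rule integrable_truncated_power_mult[OF z0 rapidly_decreasing_translate[OF g]]) simp
    from lborel_integrable_real_affine[OF this, of 1 "- real k"]
    have "integrable lborel (\<lambda>t. truncated_power (t - real k) (z - 1) * g t)"
      by simp
    then show ?thesis
      unfolding h_def by simp
  qed
  have "summable (\<lambda>k. LINT t|lborel. cmod (h k t))"
  proof (rule summable_comparison_test')
    show "summable (\<lambda>k. cmod (spline_coeff z k) * C)"
      by (intro summable_mult2 summable_norm_spline_coeff z0)
    fix k :: nat
    have "(LINT t|lborel. cmod (h k t)) = cmod (spline_coeff z k)
        * (LINT t|lborel. cmod (truncated_power (t - real k) (z - 1) * g t))"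
      unfolding h_def norm_mult[of "spline_coeff z k"] by (rule integral_mult_right_zero)
    also have "\<dots> \<le> cmod (spline_coeff z k) * C"
      unfolding shift_norm by (intro mult_left_mono C) auto
    finally show "norm (LINT t|lborel. cmod (h k t)) \<le> cmod (spline_coeff z k) * C"
      by simp
  qed
  moreover have "summable (\<lambda>k. cmod (h k t))" for t
    using summable_mult2[OF summable_B_spline[OF z, of t], of "cmod (g t)"]
    by (simp add: h_def norm_mult mult.assoc)
  ultimately have "(LINT t|lborel. (\<Sum>k. h k t)) = (\<Sum>k. integral\<^sup>L lborel (h k))"
    by (intro integral_suminf int) auto
  moreover have "B_spline z t * g t = rGamma z * (\<Sum>k. h k t)" for t
    using suminf_mult2[OF summable_norm_cancel[OF summable_B_spline[OF z, of t]], of "g t"]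
    by (simp add: B_spline_eq h_def mult.assoc)
  moreover have "integral\<^sup>L lborel (h k)
      = spline_coeff z k * (LINT s|lborel. truncated_power s (z - 1) * g (real k + s))" for k
    unfolding h_def shift[symmetric] by (rule integral_mult_right_zero)
  ultimately have "regular_dist (B_spline z) g
      = rGamma z * (\<Sum>k. spline_coeff z k * (LINT s|lborel. truncated_power s (z - 1) * g (real k + s)))"
    by (simp add: regular_dist_eq_lborel)
  also have "\<dots> = (\<Sum>k. rGamma z * (spline_coeff z k
      * (LINT s|lborel. truncated_power s (z - 1) * g (real k + s))))"
  proof (rule suminf_mult[symmetric], rule summable_norm_cancel, rule summable_comparison_test')
    show "summable (\<lambda>k. cmod (spline_coeff z k) * C)"
      by (intro summable_mult2 summable_norm_spline_coeff z0)
    fix k :: nat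
    have "cmod (LINT s|lborel. truncated_power s (z - 1) * g (real k + s)) \<le> C"
      by (rule order.trans[OF integral_norm_bound C]) simp
    then show "norm (cmod (spline_coeff z k * (LINT s|lborel. truncated_power s (z - 1) * g (real k + s))))
        \<le> cmod (spline_coeff z k) * C"
      by (simp add: norm_mult mult_left_mono)
  qed
  finally show ?thesis
    by (simp add: riesz_eq mult.left_commute)
qed

section \<open>Dirac series and the fractional derivative\<close>

lemma summable_norm_dirac:
  assumes "summable (\<lambda>k. cmod (a k))" "\<phi> \<in> schwartz_space UNIV"
  shows "summable (\<lambda>k. cmod (a k * \<phi> (real k)))"
proof (rule summable_comparison_test')
  show "summable (\<lambda>k. cmod (a k) * schwartz_seminorm UNIV 0 0 \<phi>)"
    by (intro summable_mult2 assms)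
  show "norm (cmod (a k * \<phi> (real k))) \<le> cmod (a k) * schwartz_seminorm UNIV 0 0 \<phi>" for k
    using le_schwartz_seminorm[OF assms(2), of "real k" 0 0] by (simp add: norm_mult mult_left_mono)
qed

lemma dirac_series_dual:
  assumes a: "summable (\<lambda>k. cmod (a k))" and V: "V \<subseteq> schwartz_space UNIV"
  shows "dirac_series a \<in> topological_dual (schwartz_topology UNIV) V"
proof (rule topological_dualI)
  show "linear_functional_on (schwartz_space UNIV) (dirac_series a)"
    unfolding linear_functional_on_def dirac_series_def
  proof (intro ballI allI)
    fix \<phi> \<psi> c d assume "\<phi> \<in> schwartz_space UNIV" "\<psi> \<in> schwartz_space UNIV"
    note s = this[THEN summable_norm_dirac[OF a, THEN summable_norm_cancel]]
    have "(\<lambda>k. a k * (c * \<phi> (real k) + d * \<psi> (real k)))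
        = (\<lambda>k. c * (a k * \<phi> (real k)) + d * (a k * \<psi> (real k)))"
      by (simp add: algebra_simps)
    then show "(\<Sum>k. a k * (c * \<phi> (real k) + d * \<psi> (real k)))
        = c * (\<Sum>k. a k * \<phi> (real k)) + d * (\<Sum>k. a k * \<psi> (real k))"
      by (simp only: suminf_add[OF summable_mult[OF s(1)] summable_mult[OF s(2)], symmetric]
          suminf_mult[OF s(1)] suminf_mult[OF s(2)])
  qed
  \<comment> \<open>The sup norm alone bounds the series; it occurs twice only to fit the
    two-seminorm form of \<open>topological_dualI\<close>.\<close>
  show "cmod (dirac_series a \<phi>) \<le> (\<Sum>k. cmod (a k))
      * (schwartz_seminorm UNIV 0 0 \<phi> + schwartz_seminorm UNIV 0 0 \<phi>)"
    if \<phi>: "\<phi> \<in> schwartz_space UNIV" for \<phi>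
  proof -
    have le: "cmod (\<phi> x) \<le> schwartz_seminorm UNIV 0 0 \<phi>" for x
      using le_schwartz_seminorm[OF \<phi>, of x 0 0] by simp
    have nonneg: "0 \<le> schwartz_seminorm UNIV 0 0 \<phi>"
      using le[of 0] norm_ge_zero order.trans by blast
    have "cmod (\<Sum>k. a k * \<phi> (real k)) \<le> (\<Sum>k. cmod (a k * \<phi> (real k)))"
      by (rule summable_norm[OF summable_norm_dirac[OF a \<phi>]])
    also have "\<dots> \<le> (\<Sum>k. cmod (a k) * schwartz_seminorm UNIV 0 0 \<phi>)"
      by (rule suminf_le[OF _ summable_norm_dirac[OF a \<phi>] summable_mult2[OF a]])
        (simp add: norm_mult mult_left_mono le)
    also have "\<dots> = (\<Sum>k. cmod (a k)) * schwartz_seminorm UNIV 0 0 \<phi>"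
      by (rule suminf_mult2[OF a, symmetric])
    also have "\<dots> \<le> (\<Sum>k. cmod (a k)) * (schwartz_seminorm UNIV 0 0 \<phi> + schwartz_seminorm UNIV 0 0 \<phi>)"
      using nonneg by (intro mult_left_mono suminf_nonneg[OF a]) auto
    finally show ?thesis
      by (simp add: dirac_series_def)
  qed
qed (use V in auto)

lemma frac_deriv_B_spline:
  assumes z: "Re z > 1" and \<phi>: "\<phi> \<in> schwartz_space UNIV"
  shows "frac_deriv z (regular_dist (B_spline z)) \<phi> = dirac_series (spline_coeff z) \<phi>"
proof -
  define m where "m = nat \<lceil>Re z\<rceil>"
  define w where "w = of_nat m - z"
  \<comment> \<open>Minus the m-th derivative of the pairing of \<open>K w\<close> with \<phi>(x +
    .). Of the \<open>Suc m\<close> derivatives, m come from the distributional derivative and one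
    from representing \<open>K w\<close> by an integral.\<close>
  define g where "g = (\<lambda>x. riesz (w + 1) (\<lambda>y. nderiv (Suc m) \<phi> (x + y)))"
  have "Re z \<le> real m"
    unfolding m_def by (rule real_nat_ceiling_ge)
  then have w: "Re w \<ge> 0" "Re (w + 1) > 0"
    by (auto simp: w_def)
  have half: "schwartz_space UNIV \<subseteq> schwartz_space {0..}"
    by (intro schwartz_space_antimono) auto
  note tr = subsetD[OF half schwartz_space_translate[OF \<phi>]]
  note smooth = schwartz_spaceD_smooth[OF \<phi>]
  have riesz_g: "riesz z (\<lambda>s. g (x + s)) = (-1) ^ Suc m * \<phi> x" for x
  proof -
    have \<psi>: "nderiv (Suc m) (\<lambda>u. \<phi> (x + u)) = (\<lambda>u. nderiv (Suc m) \<phi> (x + u))"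
      by (rule nderiv_translate[OF smooth])
    have "riesz z (\<lambda>s. g (x + s)) = riesz (z + (w + 1)) (nderiv (Suc m) (\<lambda>u. \<phi> (x + u)))"
      using riesz_semigroup[OF rapidly_decreasing_schwartz[OF schwartz_space_nderiv[OF tr]], of z "w + 1" "Suc m" x]
        z w by (simp add: g_def \<psi> add.assoc)
    also have "\<dots> = riesz (1 + of_nat m) (nderiv m (nderiv 1 (\<lambda>u. \<phi> (x + u))))"
      by (simp add: nderiv_nderiv w_def add.commute)
    \<comment> \<open>Lowering the order needs a positive real part throughout, so it stops at
      \<open>riesz 1\<close>, the Heaviside function; one last derivative turns that into evaluation
      at x.\<close>
    also have "\<dots> = (-1) ^ m * riesz 1 (nderiv 1 (\<lambda>u. \<phi> (x + u)))"
      by (intro riesz_add_of_nat schwartz_space_nderiv tr) auto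
    also have "\<dots> = (-1) ^ Suc m * \<phi> x"
      by (simp add: riesz_1[OF tr] del: One_nat_def)
    finally show ?thesis .
  qed
  have "(\<lambda>x. K w (\<lambda>y. \<phi> (x + y))) = (\<lambda>x. - riesz (w + 1) (\<lambda>y. nderiv (Suc 0) \<phi> (x + y)))"
    using K_eq_riesz_nderiv_1[OF tr w(1)] by (simp add: nderiv_translate[OF smooth])
  moreover have "nderiv m (\<lambda>x. - riesz (w + 1) (\<lambda>y. nderiv (Suc 0) \<phi> (x + y))) = (\<lambda>x. - g x)"
    unfolding g_def
  \<comment> \<open>The tower starts at derivative order 1, so its m-th member carries
    \<open>Suc m\<close> derivatives.\<close>
  proof (rule nderiv_eqI[of "\<lambda>n x. - riesz (w + 1) (\<lambda>y. nderiv (Suc n) \<phi> (x + y))"])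
    fix n x
    show "((\<lambda>x. - riesz (w + 1) (\<lambda>y. nderiv (Suc n) \<phi> (x + y))) has_vector_derivative
        - riesz (w + 1) (\<lambda>y. nderiv (Suc (Suc n)) \<phi> (x + y))) (at x)"
      using riesz_translate_has_vector_derivative[OF schwartz_space_nderiv[OF \<phi>, of "Suc n"] w(2), of x]
      by (intro has_vector_derivative_minus) (simp add: nderiv_nderiv)
  qed
  ultimately have "frac_deriv z (regular_dist (B_spline z)) \<phi>
      = (-1) ^ m * regular_dist (B_spline z) (\<lambda>x. - g x)"
    by (simp add: frac_deriv_def Let_def convolution_def dist_deriv_def m_def w_def)
  also have "\<dots> = (-1) ^ Suc m * regular_dist (B_spline z) g"
    by (simp add: regular_dist_def)
  also have "regular_dist (B_spline z) g = (\<Sum>k. spline_coeff z k * riesz z (\<lambda>s. g (real k + s)))"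
  proof (rule regular_dist_B_spline_eq_suminf[OF z])
    note \<psi> = schwartz_space_nderiv[OF \<phi>, of "Suc m"]
    note [measurable] = borel_measurable_schwartz[OF \<psi>]
    have "rapidly_decreasing (\<lambda>x. rGamma (w + 1)
        * (LINT y|lborel. truncated_power y (w + 1 - 1) * nderiv (Suc m) \<phi> (x + y)))"
      by (intro rapidly_decreasing_mult rapidly_decreasing_inner rapidly_decreasing_schwartz
          subsetD[OF half \<psi>] w)
    then show "rapidly_decreasing g"
      by (simp add: g_def riesz_eq)
  qed
  also have "(\<Sum>k. spline_coeff z k * riesz z (\<lambda>s. g (real k + s)))
      = (\<Sum>k. spline_coeff z k * ((-1) ^ Suc m * \<phi> (real k)))"
    by (simp only: riesz_g)
  also have "(-1) ^ Suc m * (\<Sum>k. spline_coeff z k * ((-1) ^ Suc m * \<phi> (real k)))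
      = (\<Sum>k. (-1) ^ Suc m * (spline_coeff z k * ((-1) ^ Suc m * \<phi> (real k))))"
  proof (rule suminf_mult[symmetric])
    have "summable (\<lambda>k. (-1) ^ Suc m * (spline_coeff z k * \<phi> (real k)))"
      using z by (intro summable_mult summable_norm_cancel[OF summable_norm_dirac]
          summable_norm_spline_coeff \<phi>) auto
    then show "summable (\<lambda>k. spline_coeff z k * ((-1) ^ Suc m * \<phi> (real k)))"
      by (simp only: mult.left_commute)
  qed
  also have "\<dots> = dirac_series (spline_coeff z) \<phi>"
    unfolding dirac_series_def by (intro suminf_cong) (simp flip: power_mult_distrib)
  finally show ?thesis .
qed

theorem proposition4:
  fixes z :: complex
  assumes "Re z > 1"
  shows "slowly_growing (B_spline z) \<and> polynomial_spline z (regular_dist (B_spline z))"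
proof -
  have Psi: "Psi_plus \<subseteq> schwartz_space UNIV"
    by (auto simp: Psi_plus_def Psi_def)
  have a: "summable (\<lambda>k. cmod (spline_coeff z k))"
    using assms by (intro summable_norm_spline_coeff) auto
  have "bounded (range (spline_coeff z))"
    using summable_LIMSEQ_zero[OF summable_norm_cancel[OF a]] convergent_imp_bounded by blast
  moreover have "dirac_series (spline_coeff z) \<in> Psi_plus_dual"
    unfolding Psi_plus_dual_def by (rule dirac_series_dual[OF a Psi])
  moreover have "frac_deriv z (regular_dist (B_spline z)) \<in> Psi_plus_dual"
    unfolding Psi_plus_dual_def
  proof (rule topological_dual_cong)
    show "dirac_series (spline_coeff z) \<in> topological_dual (schwartz_topology UNIV) Psi_plus"
      by (rule dirac_series_dual[OF a Psi])
  \<comment> \<open>Linear combinations of elements of \<open>Psi_plus\<close> are placed in the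
    Schwartz space, where both functionals are already known to agree.\<close>
  qed (use Psi in \<open>auto intro!: frac_deriv_B_spline[OF assms] schwartz_space_lincomb\<close>)
  ultimately have "\<exists>a. bounded (range a) \<and>
      eq_in_Psi_plus_dual (frac_deriv z (regular_dist (B_spline z))) (dirac_series a)"
    using frac_deriv_B_spline[OF assms] Psi
    by (intro exI[of _ "spline_coeff z"]) (auto simp: eq_in_Psi_plus_dual_def)
  then show ?thesis
    using assms slowly_growing_B_spline regular_dist_B_spline_half_line
    by (simp add: polynomial_spline_def)
qed

end
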